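(* The free cancellative hoop over $n\ge1$ generators $\mathrm{Free}_n(\mathbf{CH})$ is isomorphic to the positive cone $G_n^+$ of $G_n$, with $x_1,\ldots,x_n$ as free generators.
   Context: A cancellative hoop is an algebra $(A,+,\mathbin{\dot{-}},0)$ such that $(A,+,0)$ is a commutative monoid and the identities $x\mathbin{\dot{-}}x=0$, $x+(y\mathbin{\dot{-}}x)=y+(x\mathbin{\dot{-}}y)$, $(x\mathbin{\dot{-}}y)\mathbin{\dot{-}}z=x\mathbin{\dot{-}}(y+z)$, $x\mathbin{\dot{-}}(x\mathbin{\dot{-}}y)=y\mathbin{\dot{-}}(y\mathbin{\dot{-}}x)$, $(x+y)\mathbin{\dot{-}}y=x$ hold; here $\mathbin{\dot{-}}$ denotes truncated difference (on a positive cone of an $\ell$-group, $a\mathbin{\dot{-}}b=0\lor(a-b)$). $\mathrm{Free}_n(\mathbf{CH})$ denotes the free cancellative hoop on $n$ generators. For $n\ge1$, $G_n$ is the $\ell$-group enveloping the free MV-algebra on $n-1$ generators, i.e. the unique $\ell$-group with $\mathrm{Free}_{n-1}(\mathbf{MV})=\Gamma(G_n,\mathbf{1})$, where $\mathbf{1}$ is the constant function $1$ on $[0,1]^{n-1}$; its elements are all McNaughton functions $[0,1]^{n-1}\to\mathbb{R}$. $x_1,\ldots,x_{n-1}\in G_n$ are the coordinate projections $[0,1]^{n-1}\to[0,1]$ and $x_n=\mathbf{1}-(x_1\lor\cdots\lor x_{n-1})$ (if $n=1$, $x_1=\mathbf{1}$). *)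

theory Defs
  imports "HOL-Analysis.Analysis" "HOL-Algebra.Group"
begin

section \<open>Cancellative hoops\<close>

text \<open>The underlying commutative monoid is a \<^const>\<open>comm_monoid\<close> of HOL-Algebra, whose notation is
  multiplicative: \<open>\<otimes>\<close> stands for \<open>+\<close> and \<open>\<one>\<close> for \<open>0\<close>.
  The operation \<open>\<setminus>\<close> is the truncated difference.\<close>

record 'a hoop = "'a monoid" +
  tdiff :: "['a, 'a] \<Rightarrow> 'a" (infixl \<open>\<setminus>\<index>\<close> 70)

locale cancellative_hoop = comm_monoid A for A (structure) +
  assumes tdiff_closed:
      "\<lbrakk>x \<in> carrier A; y \<in> carrier A\<rbrakk> \<Longrightarrow> x \<setminus> y \<in> carrier A"
    and tdiff_self:
      "x \<in> carrier A \<Longrightarrow> x \<setminus> x = \<one>"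
    and join_commute:
      "\<lbrakk>x \<in> carrier A; y \<in> carrier A\<rbrakk> \<Longrightarrow> x \<otimes> (y \<setminus> x) = y \<otimes> (x \<setminus> y)"
    and tdiff_tdiff:
      "\<lbrakk>x \<in> carrier A; y \<in> carrier A; z \<in> carrier A\<rbrakk> \<Longrightarrow> (x \<setminus> y) \<setminus> z = x \<setminus> (y \<otimes> z)"
    and meet_commute:
      "\<lbrakk>x \<in> carrier A; y \<in> carrier A\<rbrakk> \<Longrightarrow> x \<setminus> (x \<setminus> y) = y \<setminus> (y \<setminus> x)"
    and add_tdiff_cancel:
      "\<lbrakk>x \<in> carrier A; y \<in> carrier A\<rbrakk> \<Longrightarrow> (x \<otimes> y) \<setminus> y = x"

definition hoop_hom :: "'a hoop \<Rightarrow> 'b hoop \<Rightarrow> ('a \<Rightarrow> 'b) set" where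
  "hoop_hom A B = {h \<in> hom A B. h \<one>\<^bsub>A\<^esub> = \<one>\<^bsub>B\<^esub> \<and>
     (\<forall>x\<in>carrier A. \<forall>y\<in>carrier A. h (x \<setminus>\<^bsub>A\<^esub> y) = h x \<setminus>\<^bsub>B\<^esub> h y)}"

definition hoop_iso :: "'a hoop \<Rightarrow> 'b hoop \<Rightarrow> ('a \<Rightarrow> 'b) set" where
  "hoop_iso A B = {h \<in> hoop_hom A B. bij_betw h (carrier A) (carrier B)}"

text \<open>The universal property of free generators \<open>(x i)\<^sub>i\<^sub>\<in>\<^sub>I\<close> of \<open>A\<close>, tested against
  the cancellative hoops on the type \<open>'b\<close>.  A statement in which \<open>'b\<close> is a type variable covers all
  cancellative hoops.  Homomorphisms are taken extensional on the carrier so that uniqueness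
  is not spoiled by junk values.\<close>

definition free_CH_on :: "'b itself \<Rightarrow> 'a hoop \<Rightarrow> 'i set \<Rightarrow> ('i \<Rightarrow> 'a) \<Rightarrow> bool" where
  "free_CH_on _ A I x \<longleftrightarrow>
     cancellative_hoop A \<and> (\<forall>i\<in>I. x i \<in> carrier A) \<and>
     (\<forall>(B :: 'b hoop) y. cancellative_hoop B \<and> (\<forall>i\<in>I. y i \<in> carrier B) \<longrightarrow>
        (\<exists>!h. h \<in> hoop_hom A B \<and> h \<in> extensional (carrier A) \<and> (\<forall>i\<in>I. h (x i) = y i)))"


section \<open>The free cancellative hoop\<close>

text \<open>\<open>Free_CH n\<close> is the algebra of terms over the variables \<open>1, \<dots>, n\<close> modulo the
  least congruence containing all instances of the defining identities.\<close>

datatype hoop_term =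
    HVar nat
  | HZero
  | HPlus hoop_term hoop_term
  | HDiff hoop_term hoop_term

primrec hvars :: "hoop_term \<Rightarrow> nat set" where
  "hvars (HVar i) = {i}"
| "hvars HZero = {}"
| "hvars (HPlus s t) = hvars s \<union> hvars t"
| "hvars (HDiff s t) = hvars s \<union> hvars t"

definition hterms :: "nat \<Rightarrow> hoop_term set" where
  "hterms n = {t. hvars t \<subseteq> {1..n}}"

inductive_set hoop_eq :: "nat \<Rightarrow> (hoop_term \<times> hoop_term) set" for n where
  refl: "t \<in> hterms n \<Longrightarrow> (t, t) \<in> hoop_eq n"
| sym: "(s, t) \<in> hoop_eq n \<Longrightarrow> (t, s) \<in> hoop_eq n"
| trans: "\<lbrakk>(s, t) \<in> hoop_eq n; (t, u) \<in> hoop_eq n\<rbrakk> \<Longrightarrow> (s, u) \<in> hoop_eq n"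
| cong_plus: "\<lbrakk>(s, s') \<in> hoop_eq n; (t, t') \<in> hoop_eq n\<rbrakk> \<Longrightarrow> (HPlus s t, HPlus s' t') \<in> hoop_eq n"
| cong_diff: "\<lbrakk>(s, s') \<in> hoop_eq n; (t, t') \<in> hoop_eq n\<rbrakk> \<Longrightarrow> (HDiff s t, HDiff s' t') \<in> hoop_eq n"
| plus_assoc: "\<lbrakk>s \<in> hterms n; t \<in> hterms n; u \<in> hterms n\<rbrakk>
    \<Longrightarrow> (HPlus (HPlus s t) u, HPlus s (HPlus t u)) \<in> hoop_eq n"
| plus_comm: "\<lbrakk>s \<in> hterms n; t \<in> hterms n\<rbrakk> \<Longrightarrow> (HPlus s t, HPlus t s) \<in> hoop_eq n"
| plus_zero: "s \<in> hterms n \<Longrightarrow> (HPlus HZero s, s) \<in> hoop_eq n"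
| diff_self: "s \<in> hterms n \<Longrightarrow> (HDiff s s, HZero) \<in> hoop_eq n"
| join_comm: "\<lbrakk>s \<in> hterms n; t \<in> hterms n\<rbrakk>
    \<Longrightarrow> (HPlus s (HDiff t s), HPlus t (HDiff s t)) \<in> hoop_eq n"
| diff_diff: "\<lbrakk>s \<in> hterms n; t \<in> hterms n; u \<in> hterms n\<rbrakk>
    \<Longrightarrow> (HDiff (HDiff s t) u, HDiff s (HPlus t u)) \<in> hoop_eq n"
| meet_comm: "\<lbrakk>s \<in> hterms n; t \<in> hterms n\<rbrakk>
    \<Longrightarrow> (HDiff s (HDiff s t), HDiff t (HDiff t s)) \<in> hoop_eq n"
| plus_diff: "\<lbrakk>s \<in> hterms n; t \<in> hterms n\<rbrakk> \<Longrightarrow> (HDiff (HPlus s t) t, s) \<in> hoop_eq n"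

definition Free_CH :: "nat \<Rightarrow> hoop_term set hoop" where
  "Free_CH n =
     \<lparr>carrier = hterms n // hoop_eq n,
      mult = (\<lambda>X Y. \<Union>s\<in>X. \<Union>t\<in>Y. hoop_eq n `` {HPlus s t}),
      one = hoop_eq n `` {HZero},
      tdiff = (\<lambda>X Y. \<Union>s\<in>X. \<Union>t\<in>Y. hoop_eq n `` {HDiff s t})\<rparr>"

definition free_gen :: "nat \<Rightarrow> nat \<Rightarrow> hoop_term set" where
  "free_gen n i = hoop_eq n `` {HVar i}"


section \<open>Positive cones of abelian lattice-ordered groups\<close>

record 'a lgroup = "'a monoid" +
  lsup :: "['a, 'a] \<Rightarrow> 'a"
  linf :: "['a, 'a] \<Rightarrow> 'a"

definition pos_cone :: "'a lgroup \<Rightarrow> 'a hoop" where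
  "pos_cone G =
     \<lparr>carrier = {a \<in> carrier G. lsup G \<one>\<^bsub>G\<^esub> a = a},
      mult = mult G,
      one = \<one>\<^bsub>G\<^esub>,
      tdiff = (\<lambda>a b. lsup G \<one>\<^bsub>G\<^esub> (a \<otimes>\<^bsub>G\<^esub> inv\<^bsub>G\<^esub> b))\<rparr>"


section \<open>The lattice-ordered group of McNaughton functions\<close>

text \<open>A point of \<open>[0,1]\<^sup>m\<close> is a function on \<open>{1..m}\<close>, extended by \<^const>\<open>undefined\<close>; the product
  topology of \<^typ>\<open>nat \<Rightarrow> real\<close> induces the usual topology on this set.
  For \<open>m = 0\<close> it is a singleton.\<close>

definition cube :: "nat \<Rightarrow> (nat \<Rightarrow> real) set" where
  "cube m = (\<Pi>\<^sub>E i\<in>{1..m}. {0..1})"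

definition int_affine :: "nat \<Rightarrow> ((nat \<Rightarrow> real) \<Rightarrow> real) \<Rightarrow> bool" where
  "int_affine m p \<longleftrightarrow>
     (\<exists>(a :: nat \<Rightarrow> int) (c :: int). \<forall>x. p x = (\<Sum>i=1..m. of_int (a i) * x i) + of_int c)"

definition mcnaughton :: "nat \<Rightarrow> ((nat \<Rightarrow> real) \<Rightarrow> real) \<Rightarrow> bool" where
  "mcnaughton m f \<longleftrightarrow>
     continuous_on (cube m) f \<and>
     (\<exists>P. finite P \<and> (\<forall>p\<in>P. int_affine m p) \<and> (\<forall>x\<in>cube m. \<exists>p\<in>P. f x = p x))"

text \<open>\<open>McN n\<close> is the group \<open>G\<^sub>n\<close> enveloping the free MV-algebra on \<open>n - 1\<close> generators: by
  McNaughton's theorem, the latter consists of the \<open>[0,1]\<close>-valued members of \<open>McN n\<close>,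
  that is, of the unit interval \<open>\<Gamma>(G\<^sub>n, 1)\<close>.\<close>

definition McN :: "nat \<Rightarrow> ((nat \<Rightarrow> real) \<Rightarrow> real) lgroup" where
  "McN n =
     \<lparr>carrier = {f \<in> extensional (cube (n - 1)). mcnaughton (n - 1) f},
      mult = (\<lambda>f g. \<lambda>x\<in>cube (n - 1). f x + g x),
      one = (\<lambda>x\<in>cube (n - 1). 0),
      lsup = (\<lambda>f g. \<lambda>x\<in>cube (n - 1). max (f x) (g x)),
      linf = (\<lambda>f g. \<lambda>x\<in>cube (n - 1). min (f x) (g x))\<rparr>"

definition McN_gen :: "nat \<Rightarrow> nat \<Rightarrow> (nat \<Rightarrow> real) \<Rightarrow> real" where
  "McN_gen n i =
     (\<lambda>x\<in>cube (n - 1).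
        if i < n then x i
        else if n = 1 then 1
        else 1 - Max (x ` {1..n - 1}))"

end

theory Submission
  imports Defs "HOL-Library.Lattice_Algebras"
begin

text \<open>
  \<^emph>\<open>No further relations.\<close> If two terms agree on \<open>G\<^sub>n\<^sup>+\<close>, they agree at all non-negative real points,
  because terms are positively homogeneous and every ray of the positive orthant meets the
  section \<open>x\<^sub>n + (x\<^sub>1 \<squnion> \<dots> \<squnion> x\<^sub>n\<^sub>-\<^sub>1) = 1\<close>. An inequality between terms that holds over the reals holds
  in every abelian lattice-ordered group: distributing the lattice operations outwards reduces
  it to the claim that \<open>c \<le> L\<^sub>1(y), \<dots>, c \<le> L\<^sub>k(y)\<close> imply \<open>c \<le> 0\<close> whenever no real point makes all the
  integral linear forms \<open>L\<^sub>j\<close> positive, and this follows by Fourier-Motzkin elimination, since such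
  groups are unperforated. Applied to the enveloping group of the term algebra this yields
  provable equality.

  \<^emph>\<open>Generation.\<close> For points \<open>x, y\<close> of the cube some affine piece \<open>p\<close> of a McNaughton function \<open>f\<close> has
  \<open>p x \<le> f x\<close> and \<open>f y \<le> p y\<close>. Hence \<open>f\<close> is a maximum of minima of its pieces, and for \<open>f \<ge> 0\<close> the
  pieces may be replaced by their positive parts. The positive part of an integral affine function
  is a truncated difference of sums of coordinates and of \<open>\<one> = x\<^sub>n + (x\<^sub>1 \<squnion> \<dots> \<squnion> x\<^sub>n\<^sub>-\<^sub>1)\<close>.
\<close>

subsection \<open>Inequalities in abelian lattice-ordered groups\<close>

text \<open>Since \<open>nat\<close> sends negative integers to 0, at most one of the two sums is
  nonempty, so this covers both signs without a case distinction.\<close>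

definition zsmul :: "int \<Rightarrow> 'a \<Rightarrow> 'a::ab_group_add" where
  "zsmul k x = (\<Sum>_<nat k. x) - (\<Sum>_<nat (- k). x)"

lemma zsmul_0 [simp]: "zsmul 0 x = 0"
  by (simp add: zsmul_def)

lemma zsmul_add_1: "zsmul (k + 1) x = zsmul k x + x"
proof (cases "k \<ge> 0")
  case True
  then have "nat (k + 1) = Suc (nat k)" by simp
  with True show ?thesis by (simp add: zsmul_def)
next
  case False
  then have "nat (- k) = Suc (nat (- (k + 1)))" by simp
  with False show ?thesis by (simp add: zsmul_def)
qed

lemma zsmul_diff_1: "zsmul (k - 1) x = zsmul k x - x"
  using zsmul_add_1[of "k - 1" x] by simp

lemma zsmul_1 [simp]: "zsmul 1 x = x"
  using zsmul_add_1[of 0 x] by simp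

lemma zsmul_add_left: "zsmul (j + k) x = zsmul j x + zsmul k x"
proof (induction k rule: int_induct[where k = 0])
  case (step1 i)
  then show ?case by (simp add: zsmul_add_1 add.assoc[symmetric])
next
  case (step2 i)
  then show ?case by (simp add: zsmul_diff_1 add_diff_eq)
qed simp

lemma zsmul_add_right: "zsmul k (x + y) = zsmul k x + zsmul k y"
  by (induction k rule: int_induct[where k = 0]) (simp_all add: zsmul_add_1 zsmul_diff_1)

lemma zsmul_minus_left: "zsmul (- k) x = - zsmul k x"
  using zsmul_add_left[of "- k" k x] by (simp add: eq_neg_iff_add_eq_0)

lemma zsmul_mult: "zsmul (j * k) x = zsmul j (zsmul k x)"
  by (induction j rule: int_induct[where k = 0])
    (simp_all add: zsmul_add_1 zsmul_diff_1 distrib_right left_diff_distrib zsmul_add_left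
      zsmul_minus_left flip: add_uminus_conv_diff)

lemma zsmul_zero_right [simp]: "zsmul k 0 = 0"
  by (simp add: zsmul_def)

lemma zsmul_sum: "zsmul k (sum f I) = (\<Sum>i\<in>I. zsmul k (f i))"
  by (induction I rule: infinite_finite_induct) (simp_all add: zsmul_add_right)

lemma zsmul_real [simp]: "zsmul k (x :: real) = of_int k * x"
  by (induction k rule: int_induct[where k = 0])
    (simp_all add: zsmul_add_1 zsmul_diff_1 distrib_right left_diff_distrib)

lemma zsmul_mono:
  fixes x y :: "'a::ordered_ab_group_add"
  assumes "0 \<le> k" "x \<le> y"
  shows "zsmul k x \<le> zsmul k y"
  using assms by (simp add: zsmul_def sum_mono)

text \<open>With \<open>s = 0 \<squnion> x \<squnion> \<dots> \<squnion> (k - 1) x\<close> one gets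
  \<open>x + s \<le> s \<squnion> k x\<close>.\<close>

lemma lattice_group_unperforated:
  fixes x :: "'a::lattice_ab_group_add"
  assumes "0 < k" "zsmul k x \<le> 0"
  shows "x \<le> 0"
proof -
  \<comment> \<open>Translation by \<open>x\<close> shifts the multiples of \<open>x\<close> by one,
    so the recursion makes \<open>s m\<close> the join of the multiples from 0 to
    \<open>m\<close>.\<close>
  define s where "s = rec_nat (0 :: 'a) (\<lambda>_ u. sup 0 (x + u))"
  have s_simps: "s 0 = 0" "\<And>m. s (Suc m) = sup 0 (x + s m)"
    by (simp_all add: s_def)
  have s_nonneg: "0 \<le> s m" for m
    by (cases m) (simp_all add: s_simps)
  have s_Suc: "s (Suc m) = sup (s m) (zsmul (int (Suc m)) x)" for m
  proof (induction m)
    case (Suc m)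
    have "s (Suc (Suc m)) = sup 0 (x + sup (s m) (zsmul (int (Suc m)) x))"
      using Suc s_simps(2) by metis
    also have "\<dots> = sup (sup 0 (x + s m)) (zsmul (int (Suc m)) x + x)"
      by (simp add: add_sup_distrib_left sup_assoc add.commute)
    also have "zsmul (int (Suc m)) x + x = zsmul (int (Suc (Suc m))) x"
      using zsmul_add_1[of "int (Suc m)" x] by (simp add: algebra_simps)
    finally show ?case by (simp add: s_simps(2))
  qed (simp add: s_simps)
  obtain m where m: "k = int (Suc m)"
    using assms(1) by (metis gr0_implies_Suc zero_less_imp_eq_int)
  \<comment> \<open>The top multiple \<open>zsmul k x\<close> is absorbed by \<open>s m\<close>,
    which is nonnegative; cancelling \<open>s m\<close> then gives the claim.\<close>
  have "x + s m \<le> s (Suc m)"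
    by (simp add: s_simps)
  also have "\<dots> = s m"
    using s_Suc[of m] assms(2) s_nonneg[of m] m
    by (metis order_trans sup.absorb1)
  finally show ?thesis by simp
qed

text \<open>The nontrivial half of distributivity follows from translation invariance. Lowering
  \<open>z\<close> by \<open>d - u\<close> puts it below both \<open>x\<close> and \<open>u\<close>,
  hence below \<open>e\<close>, for \<open>u = a\<close> and \<open>u = b\<close>. So
  \<open>z - e\<close> is below both \<open>d - a\<close> and \<open>d - b\<close>, whose meet is
  0.\<close>

lemma lattice_group_inf_sup_le:
  fixes x a b :: "'a::lattice_ab_group_add"
  shows "inf x (sup a b) \<le> sup (inf x a) (inf x b)"
proof -
  define d z e where "d = sup a b" and "z = inf x d" and "e = sup (inf x a) (inf x b)"
  have *: "z - e \<le> d - u" if "u \<le> d" "inf x u \<le> e" for u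
  proof -
    have "z - (d - u) \<le> x"
      using that(1) by (metis diff_ge_0_iff_ge diff_mono diff_zero inf_le1 z_def)
    moreover have "z - (d - u) \<le> u"
      by (simp add: algebra_simps z_def)
    ultimately have "z - (d - u) \<le> e"
      using that(2) by (meson le_inf_iff order_trans)
    then show ?thesis by (simp add: algebra_simps)
  qed
  have "z - e \<le> inf (d - a) (d - b)"
    using *[of a] *[of b] by (simp add: d_def e_def)
  also have "\<dots> = d - sup a b"
    by (simp add: diff_sup_eq_inf add_inf_distrib_left)
  also have "\<dots> = 0"
    by (simp add: d_def)
  finally have "z \<le> e"
    by (subst le_iff_diff_le_0)
  then show ?thesis by (simp only: z_def d_def e_def)
qed

lemma exists_strictly_between:
  fixes A B :: "'a::{linordered_field} set"
  assumes "finite A" "finite B" "\<And>a b. a \<in> A \<Longrightarrow> b \<in> B \<Longrightarrow> a < b"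
  shows "\<exists>t. (\<forall>a\<in>A. a < t) \<and> (\<forall>b\<in>B. t < b)"
proof (cases "A = {} \<or> B = {}")
  case True
  have "\<exists>t. \<forall>a\<in>A. a < t"
    using assms(1) by (metis Max_less_iff all_not_in_conv gt_ex)
  moreover have "\<exists>t. \<forall>b\<in>B. t < b"
    using assms(2) by (metis Min_gr_iff all_not_in_conv lt_ex)
  ultimately show ?thesis using True by auto
next
  case False
  then have "Max A < Min B" using assms by simp
  then obtain t where "Max A < t" "t < Min B" using dense by blast
  with False assms(1,2) show ?thesis by auto
qed

section \<open>Integral linear forms and elimination of variables\<close>

text \<open>Polymorphic in the value group, so that one coefficient vector can be evaluated both at
  real points and in a lattice-ordered group.\<close>

definition lin :: "nat set \<Rightarrow> (nat \<Rightarrow> int) \<Rightarrow> (nat \<Rightarrow> 'a) \<Rightarrow> 'a::ab_group_add" where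
  "lin I a y = (\<Sum>i\<in>I. zsmul (a i) (y i))"

lemma lin_add: "lin I (\<lambda>i. a i + b i) y = lin I a y + lin I b y"
  by (simp add: lin_def zsmul_add_left sum.distrib)

lemma lin_uminus: "lin I (\<lambda>i. - a i) y = - lin I a y"
  by (simp add: lin_def zsmul_minus_left sum_negf)

lemma lin_scale: "lin I (\<lambda>i. k * a i) y = zsmul k (lin I a y)"
  by (simp add: lin_def zsmul_mult zsmul_sum)

lemma lin_insert:
  "finite I \<Longrightarrow> j \<notin> I \<Longrightarrow> lin (insert j I) a y = zsmul (a j) (y j) + lin I a y"
  by (simp add: lin_def)

lemma lin_cong: "(\<And>i. i \<in> I \<Longrightarrow> y i = z i) \<Longrightarrow> lin I a y = lin I a z"
  by (simp add: lin_def)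

text \<open>Fourier-Motzkin elimination of the variable \<open>j\<close>, carried out in parallel over the reals and in a
  lattice-ordered group. The multiplier \<open>k\<close> of \<open>c\<close> absorbs the scaling factors.\<close>

lemma fourier_motzkin:
  fixes y :: "nat \<Rightarrow> 'g::lattice_ab_group_add"
  assumes "finite I" "finite C"
    and "\<And>k a. (k, a) \<in> C \<Longrightarrow> 0 < k \<and> zsmul k c \<le> lin I a y"
    and "\<And>r :: nat \<Rightarrow> real. \<exists>(k, a)\<in>C. lin I a r \<le> 0"
  shows "c \<le> 0"
  using assms
proof (induction I arbitrary: C rule: finite_induct)
  \<comment> \<open>The condition on real points supplies a member of \<open>C\<close>. Its form is
    an empty sum, so a positive multiple of \<open>c\<close> is nonpositive and unperforatedness
    applies.\<close>
  case empty
  then obtain k a where "(k, a) \<in> C" by fast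
  with empty.prems(2)[of k a] show ?case
    using lattice_group_unperforated by (auto simp: lin_def)
next
  case (insert j I)
  \<comment> \<open>The weights \<open>- a' j\<close> and \<open>a j\<close> are positive on
    \<open>P \<times> N\<close> and cancel the coefficient of \<open>j\<close>. The multiplier of
    \<open>c\<close> is combined with the same weights.\<close>
  define comb where "comb = (\<lambda>((k, a), (k', a')).
    (- a' j * k + a j * k', \<lambda>i. - a' j * a i + a j * a' i :: int))"
  define P N Z where "P = {(k, a) \<in> C. a j > 0}" and "N = {(k, a) \<in> C. a j < 0}"
    and "Z = {(k, a) \<in> C. a j = 0}"
  note lin_insert' = lin_insert[OF insert.hyps]
  show ?case
  proof (rule insert.IH[of "Z \<union> comb ` (P \<times> N)"])
    have "finite P" "finite N" "finite Z"
      using insert.prems(1) by (auto simp: P_def N_def Z_def intro: finite_subset)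
    then show "finite (Z \<union> comb ` (P \<times> N))" by simp
  next
    fix k a
    assume "(k, a) \<in> Z \<union> comb ` (P \<times> N)"
    then consider "(k, a) \<in> Z" | "(k, a) \<in> comb ` (P \<times> N)" by blast
    then show "0 < k \<and> zsmul k c \<le> lin I a y"
    proof cases
      case 1
      then show ?thesis
        using insert.prems(2)[of k a] by (simp add: Z_def lin_insert')
    next
      case 2
      then obtain k1 a1 k2 a2 where *: "(k1, a1) \<in> C" "a1 j > 0" "(k2, a2) \<in> C" "a2 j < 0"
        and k: "k = - a2 j * k1 + a1 j * k2" and a: "a = (\<lambda>i. - a2 j * a1 i + a1 j * a2 i)"
        by (auto simp: comb_def P_def N_def)
      have k12: "0 < k1" "0 < k2" using insert.prems(2) * by blast+
      then have "0 < k"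
        using * unfolding k by (intro add_pos_pos mult_pos_pos) auto
      moreover have "zsmul k c \<le> lin I a y"
      proof -
        have "zsmul k c = zsmul (- a2 j) (zsmul k1 c) + zsmul (a1 j) (zsmul k2 c)"
          by (simp only: k zsmul_add_left zsmul_mult)
        also have "\<dots> \<le> zsmul (- a2 j) (lin (insert j I) a1 y) + zsmul (a1 j) (lin (insert j I) a2 y)"
          using insert.prems(2) * by (intro add_mono zsmul_mono) auto
        also have "\<dots> = lin (insert j I) a y"
          by (simp only: a lin_add lin_scale)
        also have "\<dots> = lin I a y"
          by (simp add: lin_insert' a)
        finally show ?thesis .
      qed
      ultimately show ?thesis ..
    qed
  next
    fix r :: "nat \<Rightarrow> real"
    show "\<exists>(k, a)\<in>Z \<union> comb ` (P \<times> N). lin I a r \<le> 0"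
    proof (rule ccontr)
      assume neg: "\<not> ?thesis"
      \<comment> \<open>For the coordinate \<open>j\<close>, the forms in \<open>P\<close> impose
        the lower bounds \<open>A\<close> and those in \<open>N\<close> the upper bounds
        \<open>B\<close>. The negated claim puts every lower bound strictly below every upper bound,
        and a value \<open>t\<close> in between makes all forms of \<open>C\<close> positive, a
        contradiction.\<close>
      define A where "A = (\<lambda>(k, a). - lin I a r / a j) ` P"
      define B where "B = (\<lambda>(k, a). - lin I a r / a j) ` N"
      have "\<exists>t. (\<forall>u\<in>A. u < t) \<and> (\<forall>v\<in>B. t < v)"
      proof (rule exists_strictly_between)
        show "finite A" "finite B"
          using insert.prems(1) by (auto simp: A_def B_def P_def N_def intro: finite_subset)
        fix u v assume "u \<in> A" "v \<in> B"
        then obtain k1 a1 k2 a2 where *: "(k1, a1) \<in> P" "(k2, a2) \<in> N"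
          and u: "u = - lin I a1 r / a1 j" and v: "v = - lin I a2 r / a2 j"
          by (auto simp: A_def B_def)
        have sgn: "a1 j > 0" "a2 j < 0" using * by (auto simp: P_def N_def)
        have "comb ((k1, a1), (k2, a2)) \<in> comb ` (P \<times> N)"
          using * by blast
        then have "0 < lin I (\<lambda>i. - a2 j * a1 i + a1 j * a2 i) r"
          using neg unfolding comb_def by force
        also have "\<dots> = - a2 j * lin I a1 r + a1 j * lin I a2 r"
          by (simp only: lin_add lin_scale zsmul_real of_int_minus)
        finally show "u < v"
          using sgn by (simp add: u v field_simps)
      qed
      then obtain t where t: "\<And>u. u \<in> A \<Longrightarrow> u < t" "\<And>v. v \<in> B \<Longrightarrow> t < v" by blast
      obtain k a where ka: "(k, a) \<in> C" and le: "lin (insert j I) a (r(j := t)) \<le> 0"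
        using insert.prems(3) by blast
      have "lin I a (r(j := t)) = lin I a r"
        using insert.hyps by (intro lin_cong) auto
      with le have le': "a j * t + lin I a r \<le> 0"
        by (simp add: lin_insert')
      consider "a j = 0" | "a j > 0" | "a j < 0" by linarith
      then show False
      proof cases
        case 1
        then have "(k, a) \<in> Z" using ka by (simp add: Z_def)
        with neg 1 le' show False by force
      next
        case 2
        then have "(k, a) \<in> P" using ka by (simp add: P_def)
        then have "- lin I a r / a j < t"
          using t(1) unfolding A_def by force
        with 2 le' show False by (simp add: field_simps)
      next
        case 3
        then have "(k, a) \<in> N" using ka by (simp add: N_def)
        then have "t < - lin I a r / a j"
          using t(2) unfolding B_def by force
        with 3 le' show False by (simp add: field_simps)
      qed
    qed
  qed
qed

section \<open>Lattice combinations of linear forms\<close>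

datatype lterm = Lin "nat \<Rightarrow> int" | LSup lterm lterm | LInf lterm lterm

primrec leval :: "nat set \<Rightarrow> (nat \<Rightarrow> 'a) \<Rightarrow> lterm \<Rightarrow> 'a::lattice_ab_group_add" where
  "leval I y (Lin a) = lin I a y"
| "leval I y (LSup u v) = sup (leval I y u) (leval I y v)"
| "leval I y (LInf u v) = inf (leval I y u) (leval I y v)"

text \<open>A tableau in which \<open>ws\<close> holds the terms still to be decomposed and
  \<open>as\<close> the linear forms already reached. A meet contributes both arguments to one
  branch, a join splits into two branches, and a branch containing only linear forms is closed by
  \<open>fourier_motzkin\<close>.\<close>

lemma lterm_tableau:
  fixes y :: "nat \<Rightarrow> 'g::lattice_ab_group_add"
  assumes "finite I" "\<And>w. w \<in> set ws \<Longrightarrow> c \<le> leval I y w" "\<And>a. a \<in> set as \<Longrightarrow> c \<le> lin I a y"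
    and "\<And>r :: nat \<Rightarrow> real. (\<exists>w\<in>set ws. leval I r w \<le> 0) \<or> (\<exists>a\<in>set as. lin I a r \<le> 0)"
  shows "c \<le> 0"
  using assms(2-)
\<comment> \<open>The summand 1 makes the measure drop when a linear form is moved to
  \<open>as\<close>; the factor 2 pays for the additional list entry when a meet is replaced by its
  two arguments.\<close>
proof (induction "sum_list (map (\<lambda>w. 2 * size w + 1) ws)" arbitrary: ws as c rule: less_induct)
  case less
  show ?case
  proof (cases ws)
    case Nil
    show ?thesis
    proof (rule fourier_motzkin[OF assms(1)])
      show "finite (Pair 1 ` set as)" by simp
    qed (use less.prems Nil in fastforce)+
  next
    case (Cons w vs)
    show ?thesis
    proof (cases w)
      case (Lin a)
      show ?thesis
        by (rule less.hyps[of vs _ "a # as"]) (use less.prems less.prems(1)[of w] Cons Lin in auto)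
    next
      case (LInf u v)
      show ?thesis
        by (rule less.hyps[of "u # v # vs" _ as])
          (use less.prems less.prems(1)[of w] Cons LInf in \<open>auto simp: inf_min min_le_iff_disj\<close>)
    next
      case (LSup u v)
      \<comment> \<open>Replacing \<open>c\<close> by its meet with one argument of the join keeps
        all bounds and adds the bound for that branch. Distributivity then puts \<open>c\<close>
        below the join of the two branch elements.\<close>
      have "inf c (leval I y u) \<le> 0"
      proof (rule less.hyps[of "u # vs" _ as])
        show "(\<exists>w\<in>set (u # vs). leval I r w \<le> 0) \<or> (\<exists>a\<in>set as. lin I a r \<le> 0)" for r :: "nat \<Rightarrow> real"
          using less.prems(3)[of r] by (auto simp: Cons LSup)
      qed (use less.prems Cons LSup in \<open>auto intro: le_infI1\<close>)
      moreover have "inf c (leval I y v) \<le> 0"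
      proof (rule less.hyps[of "v # vs" _ as])
        show "(\<exists>w\<in>set (v # vs). leval I r w \<le> 0) \<or> (\<exists>a\<in>set as. lin I a r \<le> 0)" for r :: "nat \<Rightarrow> real"
          using less.prems(3)[of r] by (auto simp: Cons LSup)
      qed (use less.prems Cons LSup in \<open>auto intro: le_infI1\<close>)
      moreover have "c \<le> inf c (sup (leval I y u) (leval I y v))"
        using less.prems(1)[of w] Cons LSup by simp
      ultimately show ?thesis
        using lattice_group_inf_sup_le[of c "leval I y u" "leval I y v"]
        by (meson le_supI order_trans)
    qed
  qed
qed

lemma lterm_nonpos_transfer:
  fixes y :: "nat \<Rightarrow> 'g::lattice_ab_group_add"
  assumes "finite I" "\<And>r :: nat \<Rightarrow> real. leval I r w \<le> 0"
  shows "leval I y w \<le> 0"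
  by (rule lterm_tableau[where ws = "[w]" and as = "[]", OF assms(1)]) (use assms(2) in auto)

section \<open>Translation of hoop terms into lattice terms\<close>

text \<open>Addition distributes over joins and meets, so a sum can be pushed down to the linear
  leaves.\<close>

fun lplus :: "lterm \<Rightarrow> lterm \<Rightarrow> lterm" where
  "lplus (Lin a) (Lin b) = Lin (\<lambda>i. a i + b i)"
| "lplus (LSup u v) w = LSup (lplus u w) (lplus v w)"
| "lplus (LInf u v) w = LInf (lplus u w) (lplus v w)"
| "lplus w (LSup u v) = LSup (lplus w u) (lplus w v)"
| "lplus w (LInf u v) = LInf (lplus w u) (lplus w v)"

lemma leval_lplus [simp]: "leval I y (lplus u v) = leval I y u + leval I y v"
  by (induction u v rule: lplus.induct) (simp_all add: lin_add add_sup_inf_distribs)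

primrec lneg :: "lterm \<Rightarrow> lterm" where
  "lneg (Lin a) = Lin (\<lambda>i. - a i)"
| "lneg (LSup u v) = LInf (lneg u) (lneg v)"
| "lneg (LInf u v) = LSup (lneg u) (lneg v)"

lemma leval_lneg [simp]: "leval I y (lneg u) = - leval I y u"
  by (induction u) (simp_all add: lin_uminus neg_sup_eq_inf neg_inf_eq_sup)

text \<open>Variables are read as \<open>0 \<squnion> y i\<close>, so that no sign condition on \<open>y\<close> is needed.\<close>

primrec geval :: "(nat \<Rightarrow> 'a) \<Rightarrow> hoop_term \<Rightarrow> 'a::lattice_ab_group_add" where
  "geval y (HVar i) = sup 0 (y i)"
| "geval y HZero = 0"
| "geval y (HPlus s t) = geval y s + geval y t"
| "geval y (HDiff s t) = sup 0 (geval y s - geval y t)"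

primrec lterm_of :: "hoop_term \<Rightarrow> lterm" where
  "lterm_of (HVar i) = LSup (Lin (\<lambda>_. 0)) (Lin (\<lambda>j. if j = i then 1 else 0))"
| "lterm_of HZero = Lin (\<lambda>_. 0)"
| "lterm_of (HPlus s t) = lplus (lterm_of s) (lterm_of t)"
| "lterm_of (HDiff s t) = LSup (Lin (\<lambda>_. 0)) (lplus (lterm_of s) (lneg (lterm_of t)))"

lemma lin_zero [simp]: "lin I (\<lambda>_. 0) y = 0"
  by (simp add: lin_def)

lemma lin_unit: "finite I \<Longrightarrow> i \<in> I \<Longrightarrow> lin I (\<lambda>j. if j = i then 1 else 0) y = y i"
  by (simp add: lin_def if_distrib[of "\<lambda>k. zsmul k _"] cong: if_cong)

lemma leval_lterm_of: "finite I \<Longrightarrow> hvars t \<subseteq> I \<Longrightarrow> leval I y (lterm_of t) = geval y t"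
  by (induction t) (simp_all add: lin_unit)

lemma geval_real_le_transfer:
  fixes y :: "nat \<Rightarrow> 'g::lattice_ab_group_add"
  assumes "s \<in> hterms n" "t \<in> hterms n"
    and "\<And>r :: nat \<Rightarrow> real. geval r s \<le> geval r t"
  shows "geval y s \<le> geval y t"
proof -
  have vars: "hvars s \<subseteq> {1..n}" "hvars t \<subseteq> {1..n}"
    using assms(1,2) by (simp_all add: hterms_def)
  note eval = leval_lterm_of[OF finite_atLeastAtMost vars(1)]
    leval_lterm_of[OF finite_atLeastAtMost vars(2)]
  have "leval {1..n} y (lplus (lterm_of s) (lneg (lterm_of t))) \<le> 0"
    by (rule lterm_nonpos_transfer)
      (use assms(3) in \<open>simp_all only: leval_lplus leval_lneg eval finite_atLeastAtMost\<close>, simp)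
  then show ?thesis
    by (simp only: leval_lplus leval_lneg eval) simp
qed

subsection \<open>The enveloping group of the term algebra\<close>

primrec clip :: "nat \<Rightarrow> hoop_term \<Rightarrow> hoop_term" where
  "clip n (HVar i) = (if i \<in> {1..n} then HVar i else HZero)"
| "clip n HZero = HZero"
| "clip n (HPlus s t) = HPlus (clip n s) (clip n t)"
| "clip n (HDiff s t) = HDiff (clip n s) (clip n t)"

lemma hterms_simps [simp]:
  "HVar i \<in> hterms n \<longleftrightarrow> i \<in> {1..n}"
  "HZero \<in> hterms n"
  "HPlus s t \<in> hterms n \<longleftrightarrow> s \<in> hterms n \<and> t \<in> hterms n"
  "HDiff s t \<in> hterms n \<longleftrightarrow> s \<in> hterms n \<and> t \<in> hterms n"
  by (auto simp: hterms_def)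

lemma clip_in_hterms [simp]: "clip n t \<in> hterms n"
  by (induction t) simp_all

lemma clip_hterms: "t \<in> hterms n \<Longrightarrow> clip n t = t"
  by (induction t) simp_all

text \<open>The relations \<open>hoop_eq n\<close> are equivalences only on \<open>hterms n\<close>; clipping the other variables to zero
  combines them into an equivalence on the whole type of terms.\<close>

definition heq :: "hoop_term \<Rightarrow> hoop_term \<Rightarrow> bool" where
  "heq s t \<longleftrightarrow> (\<forall>n. (clip n s, clip n t) \<in> hoop_eq n)"

lemma heq_hterms: "heq s t \<Longrightarrow> s \<in> hterms n \<Longrightarrow> t \<in> hterms n \<Longrightarrow> (s, t) \<in> hoop_eq n"
  unfolding heq_def by (metis clip_hterms)

quotient_type free_hoop = hoop_term / heq
proof (rule equivpI)
  show "reflp heq"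
    by (auto simp: reflp_def heq_def intro: hoop_eq.refl)
  show "symp heq"
    by (auto simp: symp_def heq_def intro: hoop_eq.sym)
  show "transp heq"
    by (auto simp: transp_def heq_def intro: hoop_eq.trans)
qed

instantiation free_hoop :: ordered_cancel_comm_monoid_diff
begin

lift_definition zero_free_hoop :: free_hoop is HZero .

lift_definition plus_free_hoop :: "free_hoop \<Rightarrow> free_hoop \<Rightarrow> free_hoop" is HPlus
  by (simp add: heq_def hoop_eq.cong_plus)

lift_definition minus_free_hoop :: "free_hoop \<Rightarrow> free_hoop \<Rightarrow> free_hoop" is HDiff
  by (simp add: heq_def hoop_eq.cong_diff)

definition less_eq_free_hoop :: "free_hoop \<Rightarrow> free_hoop \<Rightarrow> bool" where
  "a \<le> b \<longleftrightarrow> (\<exists>c. b = a + c)" for a b :: free_hoop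

definition less_free_hoop :: "free_hoop \<Rightarrow> free_hoop \<Rightarrow> bool" where
  "a < b \<longleftrightarrow> a \<le> b \<and> \<not> b \<le> a" for a b :: free_hoop

lemma free_hoop_join_commute: "(a :: free_hoop) + (b - a) = b + (a - b)"
  by transfer (simp add: heq_def hoop_eq.join_comm)

instance
proof
  fix a b c :: free_hoop
  show assoc: "a + b + c = a + (b + c)" for a b c :: free_hoop
    by transfer (simp add: heq_def hoop_eq.plus_assoc)
  show comm: "a + b = b + a" for a b :: free_hoop
    by transfer (simp add: heq_def hoop_eq.plus_comm)
  show zero: "0 + a = a" for a :: free_hoop
    by transfer (simp add: heq_def hoop_eq.plus_zero)
  have cancel: "a + b - b = a" for a b :: free_hoop
    by transfer (simp add: heq_def hoop_eq.plus_diff)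
  then show cancel': "a + b - a = b" for a b :: free_hoop
    by (metis comm)
  show "a - b - c = a - (b + c)"
    by transfer (simp add: heq_def hoop_eq.diff_diff)
  \<comment> \<open>The join identity for \<open>a\<close> and 0 gives
    \<open>a + (0 - a) = a\<close>, and cancelling \<open>a\<close> leaves
    \<open>0 - a = 0\<close>.\<close>
  show zero_diff: "0 - a = 0" for a :: free_hoop
  proof -
    have "a + (0 - a) = a"
      using free_hoop_join_commute[of a 0] cancel[of a 0] by (simp add: zero comm[of a 0])
    then show ?thesis
      using cancel'[of a "0 - a"] cancel[of 0 a] by (simp add: zero)
  qed
  show "a \<le> a"
    unfolding less_eq_free_hoop_def by (metis comm zero)
  show "a \<le> b \<Longrightarrow> b \<le> c \<Longrightarrow> a \<le> c"
    unfolding less_eq_free_hoop_def by (metis assoc)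
  show "a = b" if "a \<le> b" "b \<le> a"
  proof -
    from that obtain c d where c: "b = a + c" and d: "a = b + d"
      by (auto simp: less_eq_free_hoop_def)
    have "a + (c + d) = a"
      by (rule assoc[of a c d, folded c, folded d, symmetric])
    then have "c + d = a - a"
      using cancel'[of a "c + d"] by simp
    \<comment> \<open>Here \<open>c + d = 0\<close>, so \<open>c = (c + d) - d = 0 - d = 0\<close>:
      there are no nontrivial additive inverses.\<close>
    then have "c = 0"
      using cancel[of 0 a] cancel[of c d] by (simp add: zero zero_diff)
    then show ?thesis
      by (simp add: c comm[of a 0] zero)
  qed
  show "c + a \<le> c + b" if "a \<le> b"
    using that unfolding less_eq_free_hoop_def by (metis assoc)
  show "a \<le> b" if "c + a \<le> c + b"
    using that unfolding less_eq_free_hoop_def by (metis assoc cancel')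
qed (simp_all add: less_eq_free_hoop_def less_free_hoop_def)

end

text \<open>If \<open>a - b = 0\<close>, the join identity exhibits \<open>b\<close> as
  \<open>a + (b - a)\<close>.\<close>

lemma free_hoop_le_iff: "(a :: free_hoop) \<le> b \<longleftrightarrow> a - b = 0"
proof
  show "a - b = 0 \<Longrightarrow> a \<le> b"
    using free_hoop_join_commute[of a b] by (auto simp: le_iff_add intro!: exI[of _ "b - a"])
qed (auto simp: le_iff_add)

section \<open>Joins and the group of differences\<close>

definition fjoin :: "free_hoop \<Rightarrow> free_hoop \<Rightarrow> free_hoop" where
  "fjoin a b = a + (b - a)"

lemma fjoin_upper: "a \<le> fjoin a b" "b \<le> fjoin a b"
  by (auto simp: fjoin_def le_iff_add intro: free_hoop_join_commute)

lemma fjoin_least: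
  assumes "a \<le> c" "b \<le> c"
  shows "fjoin a b \<le> c"
proof -
  obtain d where d: "c = a + d" using assms(1) by (auto simp: le_iff_add)
  have "b - a - d = 0"
    using assms(2) by (simp add: d diff_diff_add free_hoop_le_iff)
  then show ?thesis
    by (simp add: fjoin_def d free_hoop_le_iff)
qed

text \<open>This translation invariance makes the join of two differences independent of their
  representatives.\<close>

lemma fjoin_add: "fjoin a b + c = fjoin (a + c) (b + c)"
  by (simp add: fjoin_def ac_simps)

text \<open>The pair \<open>(a, b)\<close> represents the difference \<open>a - b\<close> in the enveloping group.\<close>

definition env_rel :: "free_hoop \<times> free_hoop \<Rightarrow> free_hoop \<times> free_hoop \<Rightarrow> bool" where
  "env_rel p q \<longleftrightarrow> fst p + snd q = fst q + snd p"

text \<open>Adding the two equations produces the common summand \<open>fst q + snd q\<close>, which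
  cancels.\<close>

lemma env_rel_trans:
  assumes "env_rel p q" "env_rel q r"
  shows "env_rel p r"
proof -
  have "fst q + snd q + (fst p + snd r) = (fst p + snd q) + (fst q + snd r)"
    by (simp add: ac_simps)
  also have "\<dots> = (fst q + snd p) + (fst r + snd q)"
    using assms by (simp add: env_rel_def)
  also have "\<dots> = fst q + snd q + (fst r + snd p)"
    by (simp add: ac_simps)
  finally show ?thesis
    by (simp add: env_rel_def)
qed

quotient_type env_group = "free_hoop \<times> free_hoop" / env_rel
proof (rule equivpI)
  show "reflp env_rel"
    by (simp add: reflp_def env_rel_def)
  show "symp env_rel"
    by (simp add: symp_def env_rel_def)
  show "transp env_rel"
    using env_rel_trans by (rule transpI)
qed

text \<open>Both sides of a comparison of two differences change by the same amount when the
  representatives are changed.\<close>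

lemma env_rel_shift:
  assumes "env_rel p p'" "env_rel q q'"
  shows "fst p + snd q + (snd p' + snd q') = fst p' + snd q' + (snd p + snd q)"
    and "fst q + snd p + (snd p' + snd q') = fst q' + snd p' + (snd p + snd q)"
proof -
  have "fst p + snd q + (snd p' + snd q') = (fst p + snd p') + (snd q + snd q')"
    by (simp only: ac_simps)
  also have "\<dots> = (fst p' + snd p) + (snd q + snd q')"
    using assms by (simp only: env_rel_def)
  finally show "fst p + snd q + (snd p' + snd q') = fst p' + snd q' + (snd p + snd q)"
    by (simp only: ac_simps)
  have "fst q + snd p + (snd p' + snd q') = (fst q + snd q') + (snd p + snd p')"
    by (simp only: ac_simps)
  also have "\<dots> = (fst q' + snd q) + (snd p + snd p')"
    using assms by (simp only: env_rel_def)
  finally show "fst q + snd p + (snd p' + snd q') = fst q' + snd p' + (snd p + snd q)"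
    by (simp only: ac_simps)
qed

instantiation env_group :: lattice_ab_group_add
begin

lift_definition zero_env_group :: env_group is "(0, 0)" .

lift_definition plus_env_group :: "env_group \<Rightarrow> env_group \<Rightarrow> env_group"
  is "\<lambda>p q. (fst p + fst q, snd p + snd q)"
proof -
  fix p p' q q'
  assume *: "env_rel p p'" "env_rel q q'"
  have "fst p + fst q + (snd p' + snd q') = (fst p + snd p') + (fst q + snd q')"
    by (simp only: ac_simps)
  also have "\<dots> = (fst p' + snd p) + (fst q' + snd q)"
    using * by (simp only: env_rel_def)
  finally show "env_rel (fst p + fst q, snd p + snd q) (fst p' + fst q', snd p' + snd q')"
    by (simp add: env_rel_def ac_simps)
qed

lift_definition uminus_env_group :: "env_group \<Rightarrow> env_group" is "\<lambda>p. (snd p, fst p)"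
  by (simp add: env_rel_def ac_simps)

definition minus_env_group :: "env_group \<Rightarrow> env_group \<Rightarrow> env_group" where
  "x - y = x + - y" for x y :: env_group

lift_definition less_eq_env_group :: "env_group \<Rightarrow> env_group \<Rightarrow> bool"
  is "\<lambda>p q. fst p + snd q \<le> fst q + snd p"
proof -
  fix p p' q q'
  assume "env_rel p p'" "env_rel q q'"
  from env_rel_shift[OF this]
  show "fst p + snd q \<le> fst q + snd p \<longleftrightarrow> fst p' + snd q' \<le> fst q' + snd p'"
    using add_le_cancel_right[of "fst p + snd q" "snd p' + snd q'" "fst q + snd p"]
      add_le_cancel_right[of "fst p' + snd q'" "snd p + snd q" "fst q' + snd p'"]
    by (simp only:)
qed

definition less_env_group :: "env_group \<Rightarrow> env_group \<Rightarrow> bool" where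
  "x < y \<longleftrightarrow> x \<le> y \<and> \<not> y \<le> x" for x y :: env_group

text \<open>Over the common subtrahend \<open>snd p + snd q\<close> the two differences have
  minuends \<open>fst p + snd q\<close> and \<open>fst q + snd p\<close>, so only the minuends need
  joining.\<close>

lift_definition sup_env_group :: "env_group \<Rightarrow> env_group \<Rightarrow> env_group"
  is "\<lambda>p q. (fjoin (fst p + snd q) (fst q + snd p), snd p + snd q)"
proof -
  fix p p' q q'
  assume "env_rel p p'" "env_rel q q'"
  from env_rel_shift[OF this]
  show "env_rel (fjoin (fst p + snd q) (fst q + snd p), snd p + snd q)
      (fjoin (fst p' + snd q') (fst q' + snd p'), snd p' + snd q')"
    by (simp only: env_rel_def fst_conv snd_conv fjoin_add)
qed

definition inf_env_group :: "env_group \<Rightarrow> env_group \<Rightarrow> env_group" where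
  "inf x y = - sup (- x) (- y)" for x y :: env_group

instance
proof
  fix x y z :: env_group
  show "x + y + z = x + (y + z)"
    by transfer (simp add: env_rel_def ac_simps)
  show "x + y = y + x"
    by transfer (simp add: env_rel_def ac_simps)
  show "0 + x = x"
    by transfer (simp add: env_rel_def)
  show "- x + x = 0"
    by transfer (simp add: env_rel_def ac_simps)
  show "x - y = x + - y"
    by (rule minus_env_group_def)
  show "x < y \<longleftrightarrow> x \<le> y \<and> \<not> y \<le> x"
    by (rule less_env_group_def)
  show "x \<le> x"
    by transfer simp
  show "x \<le> z" if "x \<le> y" "y \<le> z"
    using that
  proof transfer
    fix p q r :: "free_hoop \<times> free_hoop"
    assume "fst p + snd q \<le> fst q + snd p" "fst q + snd r \<le> fst r + snd q"
    then have "(fst p + snd q) + snd r \<le> (fst q + snd p) + snd r"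
      "(fst q + snd r) + snd p \<le> (fst r + snd q) + snd p"
      by (simp_all only: add_le_cancel_right)
    then have "fst p + snd r + snd q \<le> fst r + snd p + snd q"
      by (simp only: ac_simps)
    then show "fst p + snd r \<le> fst r + snd p"
      by (simp only: add_le_cancel_right)
  qed
  show "x = y" if "x \<le> y" "y \<le> x"
    using that by transfer (simp add: env_rel_def)
  show "z + x \<le> z + y" if "x \<le> y"
    using that
  proof transfer
    fix p q r :: "free_hoop \<times> free_hoop"
    assume "fst p + snd q \<le> fst q + snd p"
    then have "fst p + snd q + (fst r + snd r) \<le> fst q + snd p + (fst r + snd r)"
      by (simp only: add_le_cancel_right)
    then show "fst (fst r + fst p, snd r + snd p) + snd (fst r + fst q, snd r + snd q)
        \<le> fst (fst r + fst q, snd r + snd q) + snd (fst r + fst p, snd r + snd p)"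
      by (simp add: ac_simps)
  qed
  have sup1: "x \<le> sup x y" for x y :: env_group
  proof transfer
    fix p q :: "free_hoop \<times> free_hoop"
    have "fst p + snd q + snd p \<le> fjoin (fst p + snd q) (fst q + snd p) + snd p"
      by (simp only: add_le_cancel_right fjoin_upper)
    then show "fst p + snd (fjoin (fst p + snd q) (fst q + snd p), snd p + snd q)
        \<le> fst (fjoin (fst p + snd q) (fst q + snd p), snd p + snd q) + snd p"
      by (simp add: ac_simps)
  qed
  have sup2: "y \<le> sup x y" for x y :: env_group
  proof transfer
    fix p q :: "free_hoop \<times> free_hoop"
    have "fst q + snd p + snd q \<le> fjoin (fst p + snd q) (fst q + snd p) + snd q"
      by (simp only: add_le_cancel_right fjoin_upper)
    then show "fst q + snd (fjoin (fst p + snd q) (fst q + snd p), snd p + snd q)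
        \<le> fst (fjoin (fst p + snd q) (fst q + snd p), snd p + snd q) + snd q"
      by (simp add: ac_simps)
  qed
  have sup3: "sup x y \<le> z" if "x \<le> z" "y \<le> z" for x y z :: env_group
    using that
  proof transfer
    fix p q r :: "free_hoop \<times> free_hoop"
    assume "fst p + snd r \<le> fst r + snd p" "fst q + snd r \<le> fst r + snd q"
    then have "fst p + snd r + snd q \<le> fst r + snd p + snd q"
      "fst q + snd r + snd p \<le> fst r + snd q + snd p"
      by (simp_all only: add_le_cancel_right)
    then have "fjoin (fst p + snd q + snd r) (fst q + snd p + snd r) \<le> fst r + (snd p + snd q)"
      by (intro fjoin_least) (simp_all only: ac_simps)
    then show "fst (fjoin (fst p + snd q) (fst q + snd p), snd p + snd q) + snd r
        \<le> fst r + snd (fjoin (fst p + snd q) (fst q + snd p), snd p + snd q)"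
      by (simp add: fjoin_add)
  qed
  show "x \<le> sup x y" "y \<le> sup x y" "y \<le> x \<Longrightarrow> z \<le> x \<Longrightarrow> sup y z \<le> x"
    using sup1 sup2 sup3 by blast+
  have neg_le: "- x \<le> y \<longleftrightarrow> - y \<le> x" for x y :: env_group
    by transfer (simp add: ac_simps)
  have le_neg: "x \<le> - y \<longleftrightarrow> y \<le> - x" for x y :: env_group
    by transfer (simp add: ac_simps)
  have neg_mono: "- y \<le> - x" if "x \<le> y" for x y :: env_group
    using that by transfer (simp add: ac_simps)
  show "inf x y \<le> x" "inf x y \<le> y"
    unfolding inf_env_group_def using neg_le sup1 sup2 by blast+
  show "x \<le> inf y z" if "x \<le> y" "x \<le> z"
    unfolding inf_env_group_def le_neg[of x] by (intro sup3 neg_mono that)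
qed

end

definition env_of :: "free_hoop \<Rightarrow> env_group" where
  "env_of a = abs_env_group (a, 0)"

lemma env_of_inject: "env_of a = env_of b \<longleftrightarrow> a = b"
  by (simp add: env_of_def env_group.abs_eq_iff env_rel_def)

lemma env_of_nonneg: "0 \<le> env_of a"
  by (simp add: env_of_def zero_env_group_def less_eq_env_group.abs_eq)

lemma env_of_hom:
  "env_of 0 = 0"
  "env_of (a + b) = env_of a + env_of b"
  "env_of (a - b) = sup 0 (env_of a - env_of b)"
proof -
  show "env_of 0 = 0"
    by (simp add: env_of_def zero_env_group_def)
  show "env_of (a + b) = env_of a + env_of b"
    by (simp add: env_of_def plus_env_group.abs_eq)
  have "sup 0 (env_of a - env_of b) = abs_env_group (fjoin b a, b)"
    by (simp add: env_of_def zero_env_group_def plus_env_group.abs_eq uminus_env_group.abs_eq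
        minus_env_group_def sup_env_group.abs_eq)
  also have "\<dots> = env_of (a - b)"
    by (simp add: env_of_def env_group.abs_eq_iff env_rel_def fjoin_def add.commute)
  finally show "env_of (a - b) = sup 0 (env_of a - env_of b)" ..
qed

text \<open>The generic valuation: each variable goes to its own class, which is nonnegative, so the
  positive part taken by \<open>geval\<close> on variables changes nothing. Equality of terms at
  this valuation is equality of their classes.\<close>

lemma geval_env_of:
  "geval (\<lambda>i. env_of (abs_free_hoop (HVar i))) t = env_of (abs_free_hoop t)"
proof (induction t)
  case (HVar i)
  show ?case
    by (simp add: sup_absorb2 env_of_nonneg)
qed (simp_all only: geval.simps env_of_hom zero_free_hoop.abs_eq[symmetric]
  plus_free_hoop.abs_eq[symmetric] minus_free_hoop.abs_eq[symmetric])

text \<open>The inequalities transfer from the reals in both directions to the generic valuation,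
  and \<open>env_of\<close> is injective.\<close>

theorem hoop_eq_complete:
  assumes "s \<in> hterms n" "t \<in> hterms n"
    and "\<And>r :: nat \<Rightarrow> real. geval r s = geval r t"
  shows "(s, t) \<in> hoop_eq n"
proof -
  let ?y = "\<lambda>i. env_of (abs_free_hoop (HVar i))"
  have "geval ?y s \<le> geval ?y t"
    by (rule geval_real_le_transfer[OF assms(1,2)]) (simp only: assms(3) order.refl)
  moreover have "geval ?y t \<le> geval ?y s"
    by (rule geval_real_le_transfer[OF assms(2,1)]) (simp only: assms(3) order.refl)
  ultimately have "geval ?y s = geval ?y t"
    by (rule order.antisym)
  then have "heq s t"
    by (simp add: geval_env_of env_of_inject free_hoop.abs_eq_iff)
  then show ?thesis
    using assms(1,2) by (rule heq_hterms)
qed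

subsection \<open>Free generators\<close>

primrec heval :: "'a hoop \<Rightarrow> (nat \<Rightarrow> 'a) \<Rightarrow> hoop_term \<Rightarrow> 'a" where
  "heval A x (HVar i) = x i"
| "heval A x HZero = \<one>\<^bsub>A\<^esub>"
| "heval A x (HPlus s t) = heval A x s \<otimes>\<^bsub>A\<^esub> heval A x t"
| "heval A x (HDiff s t) = heval A x s \<setminus>\<^bsub>A\<^esub> heval A x t"

lemma heval_closed:
  assumes "cancellative_hoop A" "\<forall>i\<in>{1..n}. x i \<in> carrier A" "t \<in> hterms n"
  shows "heval A x t \<in> carrier A"
proof -
  interpret cancellative_hoop A by fact
  show ?thesis
    using assms(2,3) by (induction t) (auto intro: tdiff_closed)
qed

lemma hoop_eq_hterms: "(s, t) \<in> hoop_eq n \<Longrightarrow> s \<in> hterms n \<and> t \<in> hterms n"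
  by (induction rule: hoop_eq.induct) auto

lemma equiv_hoop_eq: "equiv (hterms n) (hoop_eq n)"
proof (rule equivI)
  show "hoop_eq n \<subseteq> hterms n \<times> hterms n"
    using hoop_eq_hterms by auto
  show "refl_on (hterms n) (hoop_eq n)"
    by (auto simp: refl_on_def intro: hoop_eq.refl)
  show "sym (hoop_eq n)"
    by (auto simp: sym_def intro: hoop_eq.sym)
  show "trans (hoop_eq n)"
    by (auto simp: trans_def intro: hoop_eq.trans)
qed

lemma hoop_eq_sound:
  assumes "(s, t) \<in> hoop_eq n" "cancellative_hoop A" "\<forall>i\<in>{1..n}. x i \<in> carrier A"
  shows "heval A x s = heval A x t"
proof -
  interpret cancellative_hoop A by fact
  note closed = heval_closed[OF assms(2,3)]
  show ?thesis
    using assms(1)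
    by (induction rule: hoop_eq.induct)
      (simp_all add: closed m_ac tdiff_self join_commute tdiff_tdiff meet_commute
        add_tdiff_cancel)
qed

text \<open>The operations of \<open>Free_CH\<close> are unions over all representatives; by
  congruence every pair of representatives contributes the same class.\<close>

lemma hoop_eq_class_op:
  assumes cong: "\<And>s' t'. (s, s') \<in> hoop_eq n \<Longrightarrow> (t, t') \<in> hoop_eq n \<Longrightarrow> (f s t, f s' t') \<in> hoop_eq n"
    and "s \<in> hterms n" "t \<in> hterms n"
  shows "(\<Union>s'\<in>hoop_eq n `` {s}. \<Union>t'\<in>hoop_eq n `` {t}. hoop_eq n `` {f s' t'}) = hoop_eq n `` {f s t}"
proof -
  have "hoop_eq n `` {f s' t'} = hoop_eq n `` {f s t}"
    if "s' \<in> hoop_eq n `` {s}" "t' \<in> hoop_eq n `` {t}" for s' t'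
    using that cong equiv_class_eq[OF equiv_hoop_eq] by blast
  moreover have "s \<in> hoop_eq n `` {s}" "t \<in> hoop_eq n `` {t}"
    using assms(2,3) by (auto intro: hoop_eq.refl)
  ultimately show ?thesis by blast
qed

lemma Free_CH_simps:
  "carrier (Free_CH n) = hterms n // hoop_eq n"
  "\<one>\<^bsub>Free_CH n\<^esub> = hoop_eq n `` {HZero}"
  "s \<in> hterms n \<Longrightarrow> t \<in> hterms n \<Longrightarrow>
    hoop_eq n `` {s} \<otimes>\<^bsub>Free_CH n\<^esub> hoop_eq n `` {t} = hoop_eq n `` {HPlus s t}"
  "s \<in> hterms n \<Longrightarrow> t \<in> hterms n \<Longrightarrow>
    hoop_eq n `` {s} \<setminus>\<^bsub>Free_CH n\<^esub> hoop_eq n `` {t} = hoop_eq n `` {HDiff s t}"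
  by (simp_all add: Free_CH_def hoop_eq_class_op hoop_eq.cong_plus hoop_eq.cong_diff)

text \<open>Abstracts from McNaughton functions: closure, generation by \<open>x\<close> and absence
  of further relations suffice both for the isomorphism with \<open>Free_CH n\<close> and for the
  universal property.\<close>

locale hoop_presentation = cancellative_hoop A for A :: "'a hoop" (structure) +
  fixes n :: nat and x :: "nat \<Rightarrow> 'a"
  assumes gen_closed: "\<forall>i\<in>{1..n}. x i \<in> carrier A"
    and generated: "f \<in> carrier A \<Longrightarrow> \<exists>t\<in>hterms n. heval A x t = f"
    and relations: "s \<in> hterms n \<Longrightarrow> t \<in> hterms n \<Longrightarrow> heval A x s = heval A x t \<Longrightarrow> (s, t) \<in> hoop_eq n"
begin

lemma heval_in_carrier: "t \<in> hterms n \<Longrightarrow> heval A x t \<in> carrier A"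
  using cancellative_hoop_axioms gen_closed by (rule heval_closed)

lemma heval_eq_iff:
  "s \<in> hterms n \<Longrightarrow> t \<in> hterms n \<Longrightarrow> heval A x s = heval A x t \<longleftrightarrow> (s, t) \<in> hoop_eq n"
  using relations hoop_eq_sound[OF _ cancellative_hoop_axioms gen_closed] by blast

lemma iso_Free_CH: "\<exists>h\<in>hoop_iso (Free_CH n) A. \<forall>i\<in>{1..n}. h (free_gen n i) = x i"
proof -
  \<comment> \<open>The choice of representative is harmless, because \<open>heval\<close> is
    constant on each class by soundness.\<close>
  define h where "h X = heval A x (SOME t. t \<in> X)" for X
  have h: "h (hoop_eq n `` {t}) = heval A x t" if "t \<in> hterms n" for t
  proof -
    have "t \<in> hoop_eq n `` {t}"
      using that by (simp add: hoop_eq.refl)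
    then have "(t, SOME u. u \<in> hoop_eq n `` {t}) \<in> hoop_eq n"
      by (metis Image_singleton_iff someI_ex)
    then show ?thesis
      using hoop_eq_hterms heval_eq_iff that unfolding h_def by metis
  qed
  have cases: "\<exists>t\<in>hterms n. X = hoop_eq n `` {t}" if "X \<in> hterms n // hoop_eq n" for X
    using that by (auto elim: quotientE)
  have "h \<in> hoop_hom (Free_CH n) A"
    by (auto simp: hoop_hom_def hom_def Free_CH_simps h heval_in_carrier dest!: cases)
  moreover have "inj_on h (carrier (Free_CH n))"
  proof (rule inj_onI)
    fix X Y assume XY: "X \<in> carrier (Free_CH n)" "Y \<in> carrier (Free_CH n)" and eq: "h X = h Y"
    from XY obtain s t where st: "s \<in> hterms n" "t \<in> hterms n"
      and X: "X = hoop_eq n `` {s}" and Y: "Y = hoop_eq n `` {t}"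
      using cases unfolding Free_CH_simps(1) by metis
    then have "(s, t) \<in> hoop_eq n"
      using eq by (simp add: h heval_eq_iff)
    then show "X = Y"
      unfolding X Y by (rule equiv_class_eq[OF equiv_hoop_eq])
  qed
  moreover have "h ` carrier (Free_CH n) = carrier A"
  proof
    show "h ` carrier (Free_CH n) \<subseteq> carrier A"
      by (auto simp: Free_CH_simps(1) h heval_in_carrier dest!: cases)
    show "carrier A \<subseteq> h ` carrier (Free_CH n)"
    proof
      fix f assume "f \<in> carrier A"
      then obtain t where "t \<in> hterms n" "heval A x t = f"
        using generated by blast
      then have "hoop_eq n `` {t} \<in> carrier (Free_CH n)" "h (hoop_eq n `` {t}) = f"
        by (simp_all add: Free_CH_simps h quotientI)
      then show "f \<in> h ` carrier (Free_CH n)" by blast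
    qed
  qed
  ultimately have "h \<in> hoop_iso (Free_CH n) A"
    by (simp add: hoop_iso_def bij_betw_def)
  moreover have "\<forall>i\<in>{1..n}. h (free_gen n i) = x i"
    by (simp add: free_gen_def h)
  ultimately show ?thesis by blast
qed

lemma hom_heval:
  assumes "h \<in> hoop_hom A B" "\<forall>i\<in>{1..n}. h (x i) = y i" "t \<in> hterms n"
  shows "h (heval A x t) = heval B y t"
  using assms(3) by (induction t) (use assms(1,2) heval_in_carrier in \<open>auto simp: hoop_hom_def hom_def\<close>)

lemma free: "free_CH_on TYPE('b) A {1..n} x"
  unfolding free_CH_on_def
proof (intro conjI allI impI)
  show "cancellative_hoop A" by (rule cancellative_hoop_axioms)
  show "\<forall>i\<in>{1..n}. x i \<in> carrier A" by (rule gen_closed)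
next
  fix B :: "'b hoop" and y
  assume *: "cancellative_hoop B \<and> (\<forall>i\<in>{1..n}. y i \<in> carrier B)"
  \<comment> \<open>Two terms with value \<open>f\<close> in \<open>A\<close> are provably equal by
    \<open>relations\<close>, hence have the same value in \<open>B\<close> by soundness, so the
    chosen term does not matter.\<close>
  define h where "h = (\<lambda>f\<in>carrier A. heval B y (SOME t. t \<in> hterms n \<and> heval A x t = f))"
  have h: "h (heval A x t) = heval B y t" if t: "t \<in> hterms n" for t
  proof -
    define u where "u = (SOME u. u \<in> hterms n \<and> heval A x u = heval A x t)"
    have "u \<in> hterms n \<and> heval A x u = heval A x t"
      unfolding u_def by (rule someI[of _ t]) (simp add: t)
    then have "heval B y u = heval B y t"
      using relations t hoop_eq_sound * by blast
    then show ?thesis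
      by (simp add: h_def u_def heval_in_carrier t)
  qed
  have B_closed: "heval B y t \<in> carrier B" if "t \<in> hterms n" for t
    using * that heval_closed by blast
  have "h \<in> hoop_hom A B"
    unfolding hoop_hom_def hom_def
  proof (intro CollectI conjI ballI Pi_I)
    show "h \<one> = \<one>\<^bsub>B\<^esub>" using h[of HZero] by simp
  next
    fix f g assume "f \<in> carrier A" "g \<in> carrier A"
    then obtain s t where st: "s \<in> hterms n" "heval A x s = f" "t \<in> hterms n" "heval A x t = g"
      using generated by metis
    show "h (f \<otimes> g) = h f \<otimes>\<^bsub>B\<^esub> h g" using h[of "HPlus s t"] h st by auto
    show "h (f \<setminus> g) = h f \<setminus>\<^bsub>B\<^esub> h g" using h[of "HDiff s t"] h st by auto
  next
    fix f assume "f \<in> carrier A"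
    then show "h f \<in> carrier B" using generated h B_closed by metis
  qed
  moreover have "h \<in> extensional (carrier A)"
    by (simp add: h_def)
  moreover have "\<forall>i\<in>{1..n}. h (x i) = y i"
    using h[of "HVar _"] by simp
  moreover have "g = h"
    if "g \<in> hoop_hom A B" "g \<in> extensional (carrier A)" "\<forall>i\<in>{1..n}. g (x i) = y i" for g
  proof (rule extensionalityI[OF that(2)])
    fix f assume "f \<in> carrier A"
    then show "g f = h f"
      using generated h hom_heval[OF that(1,3)] by metis
  qed (simp add: h_def)
  ultimately show "\<exists>!h. h \<in> hoop_hom A B \<and> h \<in> extensional (carrier A) \<and> (\<forall>i\<in>{1..n}. h (x i) = y i)"
    by blast
qed

end

subsection \<open>Max-min representation of McNaughton functions\<close>

text \<open>A nondecreasing affine function with a zero \<open>s\<close> in the unit interval is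
  nonpositive at 0 and nonnegative at 1, against the first assumption.\<close>

lemma affine_piece_zero_slope:
  fixes u v s :: real
  assumes "u > 0 \<or> u + v < 0" "u + v * s = 0" "0 \<le> s" "s \<le> 1"
  shows "v < 0"
proof (rule ccontr)
  assume "\<not> v < 0"
  then have "0 \<le> v * s" "v * s \<le> v"
    using assms(3,4) by (simp_all add: mult_left_le)
  with assms(1,2) \<open>\<not> v < 0\<close> show False by linarith
qed

text \<open>If every piece satisfies \<open>q 0 > 0\<close> or \<open>q 1 < 0\<close>, then \<open>g\<close> can cross zero only
  downwards, which is incompatible with \<open>g 0 = g 1 = 0\<close>.\<close>

lemma piecewise_affine_crossing_zero:
  fixes g :: "real \<Rightarrow> real"
  assumes cont: "continuous_on {0..1} g" and fin: "finite Q"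
    and aff: "\<And>q. q \<in> Q \<Longrightarrow> \<exists>u v. \<forall>t. q t = u + v * t"
    and piece: "\<And>t. t \<in> {0..1} \<Longrightarrow> \<exists>q\<in>Q. g t = q t"
    and zero: "g 0 = 0" "g 1 = 0"
  shows "\<exists>q\<in>Q. q 0 \<le> 0 \<and> 0 \<le> q 1"
proof (rule ccontr)
  assume "\<not> ?thesis"
  then have neg: "q 0 > 0 \<or> q 1 < 0" if "q \<in> Q" for q
    using that by force
  \<comment> \<open>By continuity only pieces that vanish at \<open>s\<close> can be active near a
    zero \<open>s\<close> of \<open>g\<close>, and such pieces have negative slope.\<close>
  have cross: "\<forall>\<^sub>F t in at s within {0..1}. g t * (t - s) < 0"
    if s: "s \<in> {0..1}" "g s = 0" for s
  proof -
    have "\<forall>q\<in>Q. \<forall>\<^sub>F t in at s within {0..1}. g t = q t \<longrightarrow> q s = 0"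
    proof
      fix q assume q: "q \<in> Q"
      show "\<forall>\<^sub>F t in at s within {0..1}. g t = q t \<longrightarrow> q s = 0"
      proof (cases "q s = 0")
        case False
        obtain u v where uv: "q = (\<lambda>t. u + v * t)" using aff[OF q] by auto
        have "((\<lambda>t. g t - q t) \<longlongrightarrow> g s - q s) (at s within {0..1})"
          unfolding uv using cont s(1) by (intro tendsto_intros) (auto simp: continuous_on_def)
        then have "\<forall>\<^sub>F t in at s within {0..1}. g t - q t \<noteq> 0"
          by (rule tendsto_imp_eventually_ne) (simp add: s(2) False)
        then show ?thesis by eventually_elim simp
      qed simp
    qed
    then have "\<forall>\<^sub>F t in at s within {0..1}. \<forall>q\<in>Q. g t = q t \<longrightarrow> q s = 0"
      using fin by (rule eventually_ball_finite[rotated])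
    moreover have "\<forall>\<^sub>F t in at s within {0..1}. t \<in> {0..1} \<and> t \<noteq> s"
      by (simp add: eventually_at_filter)
    ultimately show ?thesis
    proof eventually_elim
      case (elim t)
      obtain q where q: "q \<in> Q" "g t = q t" using piece elim(2) by blast
      then have qs: "q s = 0" using elim(1) by blast
      obtain u v where uv: "\<forall>t. q t = u + v * t" using aff q(1) by blast
      have "v < 0"
        by (rule affine_piece_zero_slope[of u v s]) (use neg[OF q(1)] qs uv s(1) in auto)
      have "g t * (t - s) = (q t - q s) * (t - s)"
        by (simp add: q qs)
      also have "\<dots> = v * (t - s)\<^sup>2"
        by (simp add: uv algebra_simps power2_eq_square)
      also have "\<dots> < 0"
        using \<open>v < 0\<close> elim(2) by (simp add: mult_neg_pos)
      finally show ?case .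
    qed
  qed
  obtain d where d: "d > 0" "\<And>t. t \<in> {0..1} \<Longrightarrow> t \<noteq> 0 \<Longrightarrow> dist t 0 < d \<Longrightarrow> g t * (t - 0) < 0"
    using cross[of 0] zero unfolding eventually_at by auto
  define e where "e = min (d / 2) (1 / 2)"
  have e01: "0 < e" "e < 1" "e < d"
    using d(1) by (auto simp: e_def min_def)
  then have e: "0 < e" "e < 1" "g e < 0"
    using d(2)[of e] by (auto simp: mult_less_0_iff)
  \<comment> \<open>Let \<open>s\<close> be the first zero of \<open>g\<close> after
    \<open>e\<close>, where \<open>g e < 0\<close>. Just to the left of \<open>s\<close> the
    function is positive, so the intermediate value theorem gives an earlier zero.\<close>
  define Z where "Z = {t \<in> {e..1}. g t = 0}"
  have "continuous_on {e..1} g"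
    using cont by (rule continuous_on_subset) (use e in auto)
  then have "closed Z"
    unfolding Z_def by (intro continuous_closed_preimage_constant) auto
  then have "compact Z"
    by (rule compact_eq_bounded_closed[THEN iffD2, OF conjI, rotated])
      (auto simp: Z_def intro: bounded_subset[OF bounded_closed_interval])
  moreover have "1 \<in> Z" using e zero by (simp add: Z_def)
  ultimately obtain s where s: "s \<in> Z" "\<And>t. t \<in> Z \<Longrightarrow> s \<le> t"
    using compact_attains_inf[of Z] by auto
  have "e < s" using s(1) e by (auto simp: Z_def order_less_le)
  obtain d' where d': "d' > 0" "\<And>t. t \<in> {0..1} \<Longrightarrow> t \<noteq> s \<Longrightarrow> dist t s < d' \<Longrightarrow> g t * (t - s) < 0"
    using cross[of s] s(1) e unfolding eventually_at Z_def by auto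
  define t where "t = max ((e + s) / 2) (s - d' / 2)"
  have t: "e < t" "t < s" "dist t s < d'"
    using \<open>e < s\<close> d'(1) by (auto simp: t_def dist_real_def max_def field_simps)
  then have "g t > 0"
    using d'(2)[of t] s(1) e by (auto simp: Z_def mult_less_0_iff)
  moreover have "continuous_on {e..t} g"
    using cont by (rule continuous_on_subset) (use e t s in \<open>auto simp: Z_def\<close>)
  ultimately obtain z where "e \<le> z" "z \<le> t" "g z = 0"
    using IVT'[of g e 0 t] e t by auto
  then have "z \<in> Z" using t s(1) by (auto simp: Z_def)
  with s(2)[of z] \<open>z \<le> t\<close> t show False by simp
qed

text \<open>Subtracting the chord \<open>l\<close> from \<open>g\<close> and from all pieces keeps
  the pieces affine and makes both end values of \<open>g\<close> zero.\<close>

lemma piecewise_affine_crossing: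
  fixes g :: "real \<Rightarrow> real"
  assumes cont: "continuous_on {0..1} g" and fin: "finite Q"
    and aff: "\<And>q. q \<in> Q \<Longrightarrow> \<exists>u v. \<forall>t. q t = u + v * t"
    and piece: "\<And>t. t \<in> {0..1} \<Longrightarrow> \<exists>q\<in>Q. g t = q t"
  shows "\<exists>q\<in>Q. q 0 \<le> g 0 \<and> g 1 \<le> q 1"
proof -
  define l where "l t = g 0 + (g 1 - g 0) * t" for t
  have "\<exists>q\<in>(\<lambda>q t. q t - l t) ` Q. q 0 \<le> 0 \<and> 0 \<le> q 1"
  proof (rule piecewise_affine_crossing_zero)
    show "continuous_on {0..1} (\<lambda>t. g t - l t)"
      unfolding l_def using cont by (intro continuous_intros)
    fix q assume "q \<in> (\<lambda>q t. q t - l t) ` Q"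
    then obtain q' where q': "q' \<in> Q" "q = (\<lambda>t. q' t - l t)" by blast
    then obtain u v where "\<forall>t. q' t = u + v * t" using aff by blast
    then have "\<forall>t. q t = (u - g 0) + (v - (g 1 - g 0)) * t"
      by (simp add: q' l_def algebra_simps)
    then show "\<exists>u v. \<forall>t. q t = u + v * t" by blast
  qed (use fin piece in \<open>auto simp: l_def\<close>)
  then show ?thesis by (auto simp: l_def)
qed

section \<open>From segments of the cube to max-min formulas\<close>

lemma cube_segment:
  assumes "x \<in> cube m" "y \<in> cube m" "t \<in> {0..1}"
  shows "(\<lambda>i. (1 - t) * x i + t * y i) \<in> cube m"
proof -
  have "(1 - t) * x i + t * y i \<in> {0..1}" if "i \<in> {1..m}" for i
  proof -
    have "x i \<in> {0..1}" "y i \<in> {0..1}"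
      using assms that by (auto simp: cube_def PiE_iff)
    then show ?thesis
      using assms(3) convexD[of "{0..1::real}" "x i" "y i" "1 - t" t] by simp
  qed
  \<comment> \<open>Outside \<open>{1..m}\<close> both points take the value
    \<open>undefined\<close>, and a convex combination of \<open>undefined\<close> with itself is
    again \<open>undefined\<close>.\<close>
  moreover have "(1 - t) * x i + t * y i = undefined" if "i \<notin> {1..m}" for i
  proof -
    have "x i = undefined" "y i = undefined"
      using assms that by (auto simp: cube_def PiE_iff extensional_def)
    then show ?thesis by (simp add: algebra_simps)
  qed
  ultimately show ?thesis
    by (auto simp: cube_def PiE_iff extensional_def)
qed

lemma int_affine_segment:
  assumes "int_affine m p"
  shows "p (\<lambda>i. (1 - t) * x i + t * y i) = p x + (p y - p x) * t"
proof -
  obtain a c where p: "\<And>x. p x = (\<Sum>i=1..m. of_int (a i) * x i) + of_int c"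
    using assms unfolding int_affine_def by blast
  have "(\<Sum>i=1..m. of_int (a i) * ((1 - t) * x i + t * y i)) =
    (1 - t) * (\<Sum>i=1..m. of_int (a i) * x i) + t * (\<Sum>i=1..m. of_int (a i) * y i)"
    by (simp add: sum_distrib_left algebra_simps flip: sum.distrib)
  then show ?thesis
    by (simp add: p algebra_simps)
qed

text \<open>Along the segment from \<open>x\<close> to \<open>y\<close> the pieces become affine
  functions of one real parameter, which reduces the claim to the unit interval.\<close>

lemma mcnaughton_crossing:
  assumes cont: "continuous_on (cube m) f" and "finite P" and aff: "\<And>p. p \<in> P \<Longrightarrow> int_affine m p"
    and piece: "\<And>x. x \<in> cube m \<Longrightarrow> \<exists>p\<in>P. f x = p x"
    and xy: "x \<in> cube m" "y \<in> cube m"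
  shows "\<exists>p\<in>P. p x \<le> f x \<and> f y \<le> p y"
proof -
  define z where "z t = (\<lambda>i. (1 - t) * x i + t * y i)" for t :: real
  have z: "z t \<in> cube m" if "t \<in> {0..1}" for t
    unfolding z_def using xy that by (rule cube_segment)
  have ends: "z 0 = x" "z 1 = y" by (simp_all add: z_def)
  have "\<exists>q\<in>(\<lambda>p t. p (z t)) ` P. q 0 \<le> f (z 0) \<and> f (z 1) \<le> q 1"
  proof (rule piecewise_affine_crossing)
    have "continuous_on {0..1} z"
      unfolding z_def by (intro continuous_on_coordinatewise_then_product continuous_intros)
    with cont show "continuous_on {0..1} (\<lambda>t. f (z t))"
      by (rule continuous_on_compose2) (use z in auto)
    show "finite ((\<lambda>p t. p (z t)) ` P)" using \<open>finite P\<close> by simp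
    fix q assume "q \<in> (\<lambda>p t. p (z t)) ` P"
    then show "\<exists>u v. \<forall>t. q t = u + v * t"
      using int_affine_segment[OF aff] unfolding z_def by blast
  qed (use piece z in auto)
  then show ?thesis by (auto simp: ends)
qed

lemma max_min_representation:
  assumes mcn: "mcnaughton m f" and nonneg: "\<And>x. x \<in> cube m \<Longrightarrow> 0 \<le> f x"
  obtains \<S> where "finite \<S>" "\<S> \<noteq> {}"
    "\<And>S. S \<in> \<S> \<Longrightarrow> finite S \<and> S \<noteq> {} \<and> (\<forall>p\<in>S. int_affine m p)"
    "\<And>x. x \<in> cube m \<Longrightarrow> f x = (MAX S\<in>\<S>. MIN p\<in>S. max 0 (p x))"
proof -
  obtain P where P: "continuous_on (cube m) f" "finite P" "\<And>p. p \<in> P \<Longrightarrow> int_affine m p"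
    and piece: "\<And>x. x \<in> cube m \<Longrightarrow> \<exists>p\<in>P. f x = p x"
    using mcn unfolding mcnaughton_def by blast
  \<comment> \<open>The minimum of positive parts over \<open>T y\<close> stays below
    \<open>f\<close> everywhere, by the crossing piece, and reaches \<open>f\<close> at
    \<open>y\<close>. Although \<open>y\<close> ranges over the whole cube, only finitely many sets
    \<open>T y\<close> occur, since all are subsets of \<open>P\<close>.\<close>
  define T where "T y = {p \<in> P. f y \<le> p y}" for y
  have T: "finite (T y)" "T y \<subseteq> P" for y using P(2) by (simp_all add: T_def)
  show ?thesis
  proof (rule that[of "T ` cube m"])
    show "finite (T ` cube m)"
      by (rule finite_subset[of _ "Pow P"]) (use P(2) T(2) in auto)
    have "(\<lambda>i\<in>{1..m}. 0) \<in> cube m" by (simp add: cube_def)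
    then show "T ` cube m \<noteq> {}" by blast
    show "finite S \<and> S \<noteq> {} \<and> (\<forall>p\<in>S. int_affine m p)" if "S \<in> T ` cube m" for S
      using that T P(3) piece by (force simp: T_def)
    fix x assume x: "x \<in> cube m"
    have le: "(MIN p\<in>T y. max 0 (p x)) \<le> f x" if y: "y \<in> cube m" for y
    proof -
      obtain p where p: "p \<in> P" "p x \<le> f x" "f y \<le> p y"
        using mcnaughton_crossing[OF P piece x y] by blast
      then have "(MIN p\<in>T y. max 0 (p x)) \<le> max 0 (p x)"
        using T(1) by (intro Min_le) (auto simp: T_def)
      also have "\<dots> \<le> f x" using p nonneg[OF x] by simp
      finally show ?thesis .
    qed
    have "f x \<le> (MIN p\<in>T x. max 0 (p x))"
      using piece[OF x] T(1) by (subst Min_ge_iff) (auto simp: T_def)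
    with le[OF x] have "f x = (MIN p\<in>T x. max 0 (p x))" by simp
    then show "f x = (MAX S\<in>T ` cube m. MIN p\<in>S. max 0 (p x))"
      using \<open>finite (T ` cube m)\<close> le x by (intro Max_eqI[symmetric]) auto
  qed
qed

subsection \<open>The positive cone of McNaughton functions\<close>

lemma mcnaughtonI:
  "continuous_on (cube m) f \<Longrightarrow> finite P \<Longrightarrow> (\<And>p. p \<in> P \<Longrightarrow> int_affine m p) \<Longrightarrow>
    (\<And>x. x \<in> cube m \<Longrightarrow> \<exists>p\<in>P. f x = p x) \<Longrightarrow> mcnaughton m f"
  unfolding mcnaughton_def by blast

lemma mcnaughton_cong: "(\<And>x. x \<in> cube m \<Longrightarrow> f x = g x) \<Longrightarrow> mcnaughton m f \<longleftrightarrow> mcnaughton m g"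
  unfolding mcnaughton_def by (simp cong: continuous_on_cong)

lemma mcnaughton_restrict [simp]: "mcnaughton m (\<lambda>x\<in>cube m. f x) \<longleftrightarrow> mcnaughton m f"
  by (rule mcnaughton_cong) simp

lemma mcnaughton_const: "mcnaughton m (\<lambda>_. of_int c)"
proof (rule mcnaughtonI)
  show "int_affine m p" if "p \<in> {\<lambda>_. of_int c}" for p
    using that unfolding int_affine_def by (auto intro!: exI[of _ "\<lambda>_. 0"] exI[of _ c])
qed auto

lemma mcnaughton_coord:
  assumes "i \<in> {1..m}"
  shows "mcnaughton m (\<lambda>x. x i)"
proof (rule mcnaughtonI)
  show "continuous_on (cube m) (\<lambda>x. x i)"
    by (rule continuous_on_subset[OF continuous_on_product_coordinates]) simp
  have "(\<Sum>j=1..m. of_int (if j = i then 1 else 0) * x j) = x i" for x :: "nat \<Rightarrow> real"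
    using assms by (simp add: if_distrib[of "\<lambda>k. of_int k * _"] cong: if_cong)
  then show "int_affine m p" if "p \<in> {\<lambda>x. x i}" for p
    using that unfolding int_affine_def
    by (auto intro!: exI[of _ "\<lambda>j. if j = i then 1 else 0"] exI[of _ 0])
qed auto

lemma int_affine_add:
  assumes "int_affine m p" "int_affine m q"
  shows "int_affine m (\<lambda>x. p x + q x)"
proof -
  obtain a c b d where "\<And>x. p x = (\<Sum>i=1..m. of_int (a i) * x i) + of_int c"
    "\<And>x. q x = (\<Sum>i=1..m. of_int (b i) * x i) + of_int d"
    using assms unfolding int_affine_def by metis
  then have "\<forall>x. p x + q x = (\<Sum>i=1..m. of_int (a i + b i) * x i) + of_int (c + d)"
    by (simp add: distrib_right sum.distrib)
  then show ?thesis unfolding int_affine_def by (intro exI)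
qed

lemma int_affine_uminus:
  assumes "int_affine m p"
  shows "int_affine m (\<lambda>x. - p x)"
proof -
  obtain a c where "\<And>x. p x = (\<Sum>i=1..m. of_int (a i) * x i) + of_int c"
    using assms unfolding int_affine_def by metis
  then have "\<forall>x. - p x = (\<Sum>i=1..m. of_int (- a i) * x i) + of_int (- c)"
    by (simp add: sum_negf)
  then show ?thesis unfolding int_affine_def by (intro exI)
qed

lemma mcnaughton_add:
  assumes "mcnaughton m f" "mcnaughton m g"
  shows "mcnaughton m (\<lambda>x. f x + g x)"
proof -
  obtain P Q where P: "continuous_on (cube m) f" "finite P" "\<forall>p\<in>P. int_affine m p"
      "\<forall>x\<in>cube m. \<exists>p\<in>P. f x = p x"
    and Q: "continuous_on (cube m) g" "finite Q" "\<forall>p\<in>Q. int_affine m p"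
      "\<forall>x\<in>cube m. \<exists>p\<in>Q. g x = p x"
    using assms unfolding mcnaughton_def by blast
  show ?thesis
  proof (rule mcnaughtonI)
    show "continuous_on (cube m) (\<lambda>x. f x + g x)" using P Q by (intro continuous_intros)
    show "finite ((\<lambda>(p, q) x. p x + q x) ` (P \<times> Q))" using P Q by simp
    show "int_affine m p" if "p \<in> (\<lambda>(p, q) x. p x + q x) ` (P \<times> Q)" for p
      using that P Q by (auto intro: int_affine_add)
    fix x assume "x \<in> cube m"
    then show "\<exists>p\<in>(\<lambda>(p, q) x. p x + q x) ` (P \<times> Q). f x + g x = p x"
      using P(4) Q(4) by force
  qed
qed

lemma mcnaughton_uminus:
  assumes "mcnaughton m f"
  shows "mcnaughton m (\<lambda>x. - f x)"
proof -
  obtain P where P: "continuous_on (cube m) f" "finite P" "\<forall>p\<in>P. int_affine m p"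
      "\<forall>x\<in>cube m. \<exists>p\<in>P. f x = p x"
    using assms unfolding mcnaughton_def by blast
  show ?thesis
  proof (rule mcnaughtonI)
    show "continuous_on (cube m) (\<lambda>x. - f x)" using P by (intro continuous_intros)
    show "finite ((\<lambda>p x. - p x) ` P)" using P by simp
  qed (use P in \<open>auto intro: int_affine_uminus\<close>)
qed

lemma mcnaughton_max:
  assumes "mcnaughton m f" "mcnaughton m g"
  shows "mcnaughton m (\<lambda>x. max (f x) (g x))"
proof -
  obtain P Q where P: "continuous_on (cube m) f" "finite P" "\<forall>p\<in>P. int_affine m p"
      "\<forall>x\<in>cube m. \<exists>p\<in>P. f x = p x"
    and Q: "continuous_on (cube m) g" "finite Q" "\<forall>p\<in>Q. int_affine m p"
      "\<forall>x\<in>cube m. \<exists>p\<in>Q. g x = p x"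
    using assms unfolding mcnaughton_def by blast
  show ?thesis
  proof (rule mcnaughtonI)
    show "continuous_on (cube m) (\<lambda>x. max (f x) (g x))" using P Q by (intro continuous_intros)
    show "finite (P \<union> Q)" using P Q by simp
    fix x assume "x \<in> cube m"
    then show "\<exists>p\<in>P \<union> Q. max (f x) (g x) = p x"
      using P(4) Q(4) unfolding max_def by auto
  qed (use P Q in auto)
qed

lemma mcnaughton_Max:
  assumes "finite I" "I \<noteq> {}" "I \<subseteq> {1..m}"
  shows "mcnaughton m (\<lambda>x. Max (x ` I))"
  using assms
proof (induction I rule: finite_ne_induct)
  case (insert i I)
  then have "mcnaughton m (\<lambda>x. max (x i) (Max (x ` I)))"
    by (intro mcnaughton_max mcnaughton_coord) auto
  with insert.hyps show ?case by simp
qed (simp add: mcnaughton_coord)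

section \<open>The hoop of nonnegative McNaughton functions\<close>

lemma group_McN: "group (McN n)"
proof (rule groupI)
  show "f \<otimes>\<^bsub>McN n\<^esub> g \<in> carrier (McN n)"
    if "f \<in> carrier (McN n)" "g \<in> carrier (McN n)" for f g
    using that by (simp add: McN_def mcnaughton_add)
  show "\<one>\<^bsub>McN n\<^esub> \<in> carrier (McN n)"
    using mcnaughton_const[of _ 0] by (simp add: McN_def)
  show "\<exists>g\<in>carrier (McN n). g \<otimes>\<^bsub>McN n\<^esub> f = \<one>\<^bsub>McN n\<^esub>" if "f \<in> carrier (McN n)" for f
    using that
    by (intro bexI[of _ "\<lambda>x\<in>cube (n - 1). - f x"])
      (auto simp: McN_def mcnaughton_uminus intro!: restrict_ext)
qed (auto simp: McN_def fun_eq_iff extensional_def)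

lemma inv_McN:
  assumes "f \<in> carrier (McN n)"
  shows "inv\<^bsub>McN n\<^esub> f = (\<lambda>x\<in>cube (n - 1). - f x)"
proof (rule group.inv_equality[OF group_McN _ assms])
  show "(\<lambda>x\<in>cube (n - 1). - f x) \<otimes>\<^bsub>McN n\<^esub> f = \<one>\<^bsub>McN n\<^esub>"
    by (auto simp: McN_def intro!: restrict_ext)
  show "(\<lambda>x\<in>cube (n - 1). - f x) \<in> carrier (McN n)"
    using assms by (simp add: McN_def mcnaughton_uminus)
qed

lemma carrier_pos_cone_McN:
  "f \<in> carrier (pos_cone (McN n)) \<longleftrightarrow>
    f \<in> extensional (cube (n - 1)) \<and> mcnaughton (n - 1) f \<and> (\<forall>x\<in>cube (n - 1). 0 \<le> f x)"
proof -
  have "(\<lambda>x\<in>cube (n - 1). max ((\<lambda>x\<in>cube (n - 1). 0) x) (f x)) = f \<longleftrightarrow> (\<forall>x\<in>cube (n - 1). 0 \<le> f x)"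
    if "f \<in> extensional (cube (n - 1))"
    using that by (auto simp: fun_eq_iff extensional_def max_def)
  then show ?thesis by (auto simp: pos_cone_def McN_def)
qed

lemma mult_pos_cone_McN: "f \<otimes>\<^bsub>pos_cone (McN n)\<^esub> g = (\<lambda>x\<in>cube (n - 1). f x + g x)"
  and one_pos_cone_McN: "\<one>\<^bsub>pos_cone (McN n)\<^esub> = (\<lambda>x\<in>cube (n - 1). 0)"
  by (simp_all add: pos_cone_def McN_def)

lemma tdiff_pos_cone_McN:
  assumes "g \<in> carrier (pos_cone (McN n))"
  shows "f \<setminus>\<^bsub>pos_cone (McN n)\<^esub> g = (\<lambda>x\<in>cube (n - 1). max 0 (f x - g x))"
proof -
  have "g \<in> carrier (McN n)" using assms by (simp add: pos_cone_def)
  from inv_McN[OF this] show ?thesis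
    by (auto simp: pos_cone_def McN_def intro!: restrict_ext)
qed

lemmas pos_cone_McN_simps =
  mult_pos_cone_McN one_pos_cone_McN tdiff_pos_cone_McN

lemma mcnaughton_tdiff:
  assumes "mcnaughton m f" "mcnaughton m g"
  shows "mcnaughton m (\<lambda>x. max 0 (f x - g x))"
  using mcnaughton_max[OF mcnaughton_const[of m 0] mcnaughton_add[OF assms(1) mcnaughton_uminus[OF assms(2)]]]
  by simp

lemma cancellative_hoop_pos_cone_McN: "cancellative_hoop (pos_cone (McN n))"
proof -
  let ?A = "pos_cone (McN n)" and ?C = "cube (n - 1)"
  have add: "f \<otimes>\<^bsub>?A\<^esub> g \<in> carrier ?A" if "f \<in> carrier ?A" "g \<in> carrier ?A" for f g
    using that by (simp add: carrier_pos_cone_McN mult_pos_cone_McN mcnaughton_add)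
  have diff: "f \<setminus>\<^bsub>?A\<^esub> g \<in> carrier ?A" if "f \<in> carrier ?A" "g \<in> carrier ?A" for f g
    using that by (simp add: tdiff_pos_cone_McN) (simp add: carrier_pos_cone_McN mcnaughton_tdiff)
  have zero: "\<one>\<^bsub>?A\<^esub> \<in> carrier ?A"
    using mcnaughton_const[of "n - 1" 0] by (simp add: carrier_pos_cone_McN one_pos_cone_McN)
  have eq: "f = g" if "f \<in> carrier ?A" "g \<in> carrier ?A" "\<And>x. x \<in> ?C \<Longrightarrow> f x = g x" for f g
    using that by (intro extensionalityI[of f ?C g]) (auto simp: carrier_pos_cone_McN)
  have nonneg: "0 \<le> f x" if "f \<in> carrier ?A" "x \<in> ?C" for f x
    using that by (simp add: carrier_pos_cone_McN)
  have at: "(f \<otimes>\<^bsub>?A\<^esub> g) x = f x + g x" "\<one>\<^bsub>?A\<^esub> x = 0"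
    "g \<in> carrier ?A \<Longrightarrow> (f \<setminus>\<^bsub>?A\<^esub> g) x = max 0 (f x - g x)" if "x \<in> ?C" for f g x
    using that by (simp_all add: pos_cone_McN_simps)
  interpret comm_monoid ?A
  proof (rule comm_monoidI)
    fix f g k assume "f \<in> carrier ?A" "g \<in> carrier ?A" "k \<in> carrier ?A"
    then show "f \<otimes>\<^bsub>?A\<^esub> g \<otimes>\<^bsub>?A\<^esub> k = f \<otimes>\<^bsub>?A\<^esub> (g \<otimes>\<^bsub>?A\<^esub> k)"
      by (intro eq) (simp_all add: add at)
  next
    fix f g assume "f \<in> carrier ?A" "g \<in> carrier ?A"
    then show "f \<otimes>\<^bsub>?A\<^esub> g = g \<otimes>\<^bsub>?A\<^esub> f"
      by (intro eq) (simp_all add: add at)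
  next
    fix f assume "f \<in> carrier ?A"
    then show "\<one>\<^bsub>?A\<^esub> \<otimes>\<^bsub>?A\<^esub> f = f"
      by (intro eq) (simp_all add: add zero at)
  qed (fact add zero)+
  show ?thesis
  proof
    fix f assume "f \<in> carrier ?A"
    then show "f \<setminus>\<^bsub>?A\<^esub> f = \<one>\<^bsub>?A\<^esub>"
      by (intro eq) (simp_all add: diff zero at)
  next
    fix f g assume fg: "f \<in> carrier ?A" "g \<in> carrier ?A"
    then show "f \<setminus>\<^bsub>?A\<^esub> g \<in> carrier ?A" by (rule diff)
    from fg show "f \<otimes>\<^bsub>?A\<^esub> (g \<setminus>\<^bsub>?A\<^esub> f) = g \<otimes>\<^bsub>?A\<^esub> (f \<setminus>\<^bsub>?A\<^esub> g)"
      by (intro eq) (simp_all add: add diff at max_def)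
    from fg show "f \<setminus>\<^bsub>?A\<^esub> (f \<setminus>\<^bsub>?A\<^esub> g) = g \<setminus>\<^bsub>?A\<^esub> (g \<setminus>\<^bsub>?A\<^esub> f)"
      by (intro eq) (simp_all add: diff at max_def)
    from fg show "(f \<otimes>\<^bsub>?A\<^esub> g) \<setminus>\<^bsub>?A\<^esub> g = f"
      by (intro eq) (simp_all add: add diff at nonneg max_absorb2)
  next
    fix f g k assume fgk: "f \<in> carrier ?A" "g \<in> carrier ?A" "k \<in> carrier ?A"
    show "(f \<setminus>\<^bsub>?A\<^esub> g) \<setminus>\<^bsub>?A\<^esub> k = f \<setminus>\<^bsub>?A\<^esub> (g \<otimes>\<^bsub>?A\<^esub> k)"
    proof (rule eq)
      fix x assume x: "x \<in> ?C"
      \<comment> \<open>Nonnegativity of \<open>k x\<close> matters: subtracting a negative number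
        after the inner truncation could give a larger result.\<close>
      from nonneg[OF fgk(3) x]
      have "max 0 (max 0 (f x - g x) - k x) = max 0 (f x - (g x + k x))" by linarith
      with fgk x show "((f \<setminus>\<^bsub>?A\<^esub> g) \<setminus>\<^bsub>?A\<^esub> k) x = (f \<setminus>\<^bsub>?A\<^esub> (g \<otimes>\<^bsub>?A\<^esub> k)) x"
        by (simp add: at add diff)
    qed (use fgk in \<open>simp_all add: add diff\<close>)
  qed
qed

section \<open>Relations between the generators\<close>

text \<open>On the cube the last generator and the maximum of the others (0 if there are none) add
  up to 1. Hence the scaling factor has to be this sum formed from the positive parts of
  \<open>r\<close>, which is \<open>l\<close>.\<close>

lemma ray_meets_generators:
  fixes r :: "nat \<Rightarrow> real"
  assumes "n \<ge> 1"
  obtains x l where "x \<in> cube (n - 1)" "0 \<le> l" "\<And>i. i \<in> {1..n} \<Longrightarrow> max 0 (r i) = l * McN_gen n i x"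
proof -
  define s where "s i = max 0 (r i)" for i
  \<comment> \<open>The inserted 0 gives \<open>M = 0\<close> when \<open>n = 1\<close>, where
    \<open>{1..n - 1}\<close> is empty.\<close>
  define M where "M = Max (insert 0 (s ` {1..n - 1}))"
  define l where "l = s n + M"
  have s_nonneg: "0 \<le> s i" for i by (simp add: s_def)
  have M: "0 \<le> M" "\<And>i. i \<in> {1..n - 1} \<Longrightarrow> s i \<le> M"
    unfolding M_def by (intro Max_ge; simp)+
  have l: "0 \<le> l" "M \<le> l" using s_nonneg M(1) by (simp_all add: l_def)
  \<comment> \<open>If \<open>l = 0\<close>, division by zero yields coordinates 0, still a point of
    the cube; all positive parts of \<open>r\<close> on \<open>{1..n}\<close> vanish in that
    case.\<close>
  define x where "x = (\<lambda>i\<in>{1..n - 1}. s i / l)"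
  have x: "x \<in> cube (n - 1)"
    using s_nonneg l M by (fastforce simp: x_def cube_def divide_le_eq_1 intro!: divide_nonneg_nonneg)
  have "s i = l * McN_gen n i x" if i: "i \<in> {1..n}" for i
  proof (cases "l = 0")
    case True
    then have "s n = 0" "M = 0"
      using s_nonneg[of n] M(1) by (simp_all add: l_def add_nonneg_eq_0_iff)
    then have "s i = 0"
      using i M(2)[of i] s_nonneg[of i] by (cases "i = n") force+
    with True show ?thesis by simp
  next
    case False
    show ?thesis
    proof (cases "i < n")
      case True
      with i False x show ?thesis by (auto simp: McN_gen_def x_def)
    next
      case ge: False
      then have "i = n" using i by simp
      show ?thesis
      proof (cases "n = 1")
        case True
        then show ?thesis
          using x \<open>i = n\<close> by (simp add: McN_gen_def l_def M_def)
      next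
        case n: False
        with assms have ne: "{1..n - 1} \<noteq> {}" by simp
        have "x ` {1..n - 1} = (\<lambda>a. a / l) ` s ` {1..n - 1}"
          by (force simp: x_def)
        moreover have "mono (\<lambda>a. a / l)"
          using l(1) by (auto intro!: monoI divide_right_mono)
        ultimately have "Max (x ` {1..n - 1}) = Max (s ` {1..n - 1}) / l"
          using mono_Max_commute[of "\<lambda>a. a / l" "s ` {1..n - 1}"] ne by simp
        also have "Max (s ` {1..n - 1}) = M"
        proof -
          have "0 \<le> Max (s ` {1..n - 1})"
            using ne s_nonneg by (subst Max_ge_iff) auto
          then show ?thesis
            using ne by (simp add: M_def max_def)
        qed
        finally show ?thesis
          using x n False \<open>i = n\<close> by (simp add: McN_gen_def l_def field_simps)
      qed
    qed
  qed
  with x l(1) that show thesis unfolding s_def by blast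
qed

text \<open>Positive homogeneity of hoop terms. It is stated for positive parts because these are
  all that \<open>geval\<close> sees of a valuation.\<close>

lemma geval_scale:
  fixes r z :: "nat \<Rightarrow> real"
  assumes "0 \<le> l" "\<And>i. i \<in> hvars t \<Longrightarrow> max 0 (r i) = l * max 0 (z i)"
  shows "geval r t = l * geval z t"
  using assms(2)
proof (induction t)
  case (HDiff s t)
  then show ?case
    using assms(1) by (simp add: sup_max max_mult_distrib_left right_diff_distrib)
qed (simp_all add: sup_max distrib_left)

lemma McN_gen_nonneg:
  assumes "x \<in> cube (n - 1)" "i \<in> {1..n}"
  shows "0 \<le> McN_gen n i x"
proof -
  have x: "x j \<in> {0..1}" if "j \<in> {1..n - 1}" for j
    using assms(1) that by (auto simp: cube_def PiE_iff)
  have "Max (x ` {1..n - 1}) \<le> 1" if "n \<noteq> 1"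
    using x assms(2) that by (subst Max_le_iff) auto
  then show ?thesis
    using assms x[of i] by (auto simp: McN_gen_def)
qed

lemma McN_gen_in_pos_cone:
  assumes "i \<in> {1..n}"
  shows "McN_gen n i \<in> carrier (pos_cone (McN n))"
proof -
  have "mcnaughton (n - 1) (\<lambda>x. if i < n then x i else if n = 1 then 1 else 1 - Max (x ` {1..n - 1}))"
  proof -
    consider "i < n" | "i = n" "n = 1" | "i = n" "n > 1" using assms by force
    then show ?thesis
    proof cases
      case 1
      then show ?thesis using assms by (simp add: mcnaughton_coord)
    next
      case 2
      then show ?thesis using mcnaughton_const[of "n - 1" 1] by simp
    next
      case 3
      then have "mcnaughton (n - 1) (\<lambda>x. of_int 1 + - Max (x ` {1..n - 1}))"
        by (intro mcnaughton_add mcnaughton_const mcnaughton_uminus mcnaughton_Max) auto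
      with 3 show ?thesis by (simp del: minus_Max_eq_Min)
    qed
  qed
  moreover have "McN_gen n i \<in> extensional (cube (n - 1))"
    by (simp add: McN_gen_def)
  ultimately show ?thesis
    using McN_gen_nonneg[OF _ assms] by (simp add: carrier_pos_cone_McN) (simp add: McN_gen_def)
qed

text \<open>The positive part that \<open>geval\<close> applies to variables is harmless here,
  because the generators are nonnegative on the cube.\<close>

lemma heval_pos_cone_McN:
  assumes "t \<in> hterms n" "x \<in> cube (n - 1)"
  shows "heval (pos_cone (McN n)) (McN_gen n) t x = geval (\<lambda>i. McN_gen n i x) t"
  using assms(1)
proof (induction t)
  case (HVar i)
  then show ?case using McN_gen_nonneg[OF assms(2)] by (simp add: sup_max)
next
  case (HDiff s t)
  \<comment> \<open>The truncated difference involves a group inverse, whose pointwise form is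
    available for members of the carrier.\<close>
  have "heval (pos_cone (McN n)) (McN_gen n) t \<in> carrier (pos_cone (McN n))"
    using HDiff.prems McN_gen_in_pos_cone
    by (intro heval_closed[OF cancellative_hoop_pos_cone_McN, where n = n]) auto
  with HDiff assms(2) show ?case by (simp add: tdiff_pos_cone_McN sup_max)
qed (use assms(2) in \<open>simp_all add: pos_cone_McN_simps\<close>)

lemma pos_cone_McN_relations:
  assumes "n \<ge> 1" "s \<in> hterms n" "t \<in> hterms n"
    and "heval (pos_cone (McN n)) (McN_gen n) s = heval (pos_cone (McN n)) (McN_gen n) t"
  shows "(s, t) \<in> hoop_eq n"
  using assms(2,3)
proof (rule hoop_eq_complete)
  fix r :: "nat \<Rightarrow> real"
  obtain x l where x: "x \<in> cube (n - 1)" and l: "0 \<le> l"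
    and r: "\<And>i. i \<in> {1..n} \<Longrightarrow> max 0 (r i) = l * McN_gen n i x"
    using ray_meets_generators[OF assms(1)] by blast
  have *: "geval r u = l * heval (pos_cone (McN n)) (McN_gen n) u x" if "u \<in> hterms n" for u
  proof -
    have "max 0 (r i) = l * max 0 (McN_gen n i x)" if "i \<in> hvars u" for i
    proof -
      have "i \<in> {1..n}" using that \<open>u \<in> hterms n\<close> by (auto simp: hterms_def)
      then show ?thesis using McN_gen_nonneg[OF x] r by (simp add: max_absorb2)
    qed
    then show ?thesis
      using geval_scale[OF l] heval_pos_cone_McN[OF that x] by simp
  qed
  show "geval r s = geval r t"
    using *[OF assms(2)] *[OF assms(3)] assms(4) by simp
qed

section \<open>Generation: functions represented by hoop terms\<close>

text \<open>Agreement is demanded on the cube only, so that pointwise expressions can be used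
  without restricting them to the cube.\<close>

definition term_fun :: "nat \<Rightarrow> ((nat \<Rightarrow> real) \<Rightarrow> real) \<Rightarrow> bool" where
  "term_fun n f \<longleftrightarrow> (\<exists>t\<in>hterms n. \<forall>x\<in>cube (n - 1). geval (\<lambda>i. McN_gen n i x) t = f x)"

lemma geval_nonneg:
  fixes y :: "nat \<Rightarrow> 'a::lattice_ab_group_add"
  shows "0 \<le> geval y t"
  by (induction t) simp_all

lemma term_fun_cong:
  "term_fun n f \<Longrightarrow> (\<And>x. x \<in> cube (n - 1) \<Longrightarrow> f x = g x) \<Longrightarrow> term_fun n g"
  by (simp add: term_fun_def)

lemma term_fun_nonneg: "term_fun n f \<Longrightarrow> x \<in> cube (n - 1) \<Longrightarrow> 0 \<le> f x"
  unfolding term_fun_def using geval_nonneg by metis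

lemma term_fun_gen: "i \<in> {1..n} \<Longrightarrow> term_fun n (McN_gen n i)"
  unfolding term_fun_def using McN_gen_nonneg
  by (intro bexI[of _ "HVar i"]) (auto simp: sup_max)

lemma term_fun_zero: "term_fun n (\<lambda>_. 0)"
  unfolding term_fun_def by (intro bexI[of _ HZero]) auto

lemma term_fun_add: "term_fun n f \<Longrightarrow> term_fun n g \<Longrightarrow> term_fun n (\<lambda>x. f x + g x)"
  unfolding term_fun_def
  by (elim bexE, rule_tac x = "HPlus t ta" in bexI) auto

lemma term_fun_tdiff: "term_fun n f \<Longrightarrow> term_fun n g \<Longrightarrow> term_fun n (\<lambda>x. max 0 (f x - g x))"
  unfolding term_fun_def
  by (elim bexE, rule_tac x = "HDiff t ta" in bexI) (auto simp: sup_max)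

text \<open>The join in a hoop: \<open>f\<close> plus the truncated difference of \<open>g\<close>
  and \<open>f\<close>.\<close>

lemma term_fun_max:
  assumes "term_fun n f" "term_fun n g"
  shows "term_fun n (\<lambda>x. max (f x) (g x))"
  using term_fun_add[OF assms(1) term_fun_tdiff[OF assms(2,1)]]
  by (rule term_fun_cong) (simp add: max_def)

text \<open>The meet in a hoop: \<open>f\<close> truncatedly diminished by the truncated difference
  of \<open>f\<close> and \<open>g\<close>. The outer truncation has no effect because both
  functions are nonnegative on the cube.\<close>

lemma term_fun_min:
  assumes "term_fun n f" "term_fun n g"
  shows "term_fun n (\<lambda>x. min (f x) (g x))"
  using term_fun_tdiff[OF assms(1) term_fun_tdiff[OF assms]]
  by (rule term_fun_cong)
    (use assms[THEN term_fun_nonneg] in \<open>auto simp: max_def min_def\<close>)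

lemma term_fun_Max:
  assumes "finite I" "I \<noteq> {}" "\<And>i. i \<in> I \<Longrightarrow> term_fun n (f i)"
  shows "term_fun n (\<lambda>x. MAX i\<in>I. f i x)"
  using assms
proof (induction I rule: finite_ne_induct)
  case (insert i I)
  then have "term_fun n (\<lambda>x. max (f i x) (MAX i\<in>I. f i x))"
    by (intro term_fun_max) auto
  with insert.hyps show ?case by simp
qed simp

lemma term_fun_Min:
  assumes "finite I" "I \<noteq> {}" "\<And>i. i \<in> I \<Longrightarrow> term_fun n (f i)"
  shows "term_fun n (\<lambda>x. MIN i\<in>I. f i x)"
  using assms
proof (induction I rule: finite_ne_induct)
  case (insert i I)
  then have "term_fun n (\<lambda>x. min (f i x) (MIN i\<in>I. f i x))"
    by (intro term_fun_min) auto
  with insert.hyps show ?case by simp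
qed simp

lemma term_fun_sum:
  assumes "\<And>i. i \<in> I \<Longrightarrow> term_fun n (f i)"
  shows "term_fun n (\<lambda>x. \<Sum>i\<in>I. f i x)"
  using assms
  by (induction I rule: infinite_finite_induct) (auto intro: term_fun_zero term_fun_add)

lemma term_fun_of_nat_mult: "term_fun n f \<Longrightarrow> term_fun n (\<lambda>x. of_nat k * f x)"
  by (induction k) (auto intro: term_fun_zero term_fun_add simp: distrib_right)

lemma term_fun_coord:
  assumes "i \<in> {1..n - 1}"
  shows "term_fun n (\<lambda>x. x i)"
proof -
  have "i \<in> {1..n}" "i < n" using assms by auto
  from term_fun_gen[OF this(1)] show ?thesis
    by (rule term_fun_cong) (use \<open>i < n\<close> in \<open>simp add: McN_gen_def\<close>)
qed

lemma term_fun_one: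
  assumes "n \<ge> 1"
  shows "term_fun n (\<lambda>_. 1)"
proof (cases "n = 1")
  case True
  have "term_fun n (McN_gen n n)" using assms by (intro term_fun_gen) simp
  then show ?thesis
    by (rule term_fun_cong) (use True in \<open>simp add: McN_gen_def\<close>)
next
  case False
  have "term_fun n (\<lambda>x. McN_gen n n x + (MAX i\<in>{1..n - 1}. x i))"
    using assms False
    by (intro term_fun_add term_fun_gen term_fun_Max term_fun_coord) auto
  then show ?thesis
    by (rule term_fun_cong) (use False in \<open>simp add: McN_gen_def\<close>)
qed

lemma term_fun_int_affine:
  assumes "n \<ge> 1" "int_affine (n - 1) p"
  shows "term_fun n (\<lambda>x. max 0 (p x))"
proof -
  obtain a c where p: "\<And>x. p x = (\<Sum>i=1..n - 1. of_int (a i) * x i) + of_int c"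
    using assms(2) unfolding int_affine_def by blast
  \<comment> \<open>Since \<open>nat\<close> sends negative integers to 0, \<open>q b d\<close>
    keeps only the positive coefficients. Thus \<open>p\<close> is the difference of
    \<open>q a c\<close> and the same expression for the negated coefficients, both of which are
    sums of generated functions.\<close>
  define q where "q b d x = (\<Sum>i=1..n - 1. of_nat (nat (b i)) * x i) + of_nat (nat d) * 1"
    for b d and x :: "nat \<Rightarrow> real"
  have q: "term_fun n (q b d)" for b d
    unfolding q_def
    by (intro term_fun_add term_fun_sum term_fun_of_nat_mult term_fun_coord term_fun_one assms(1))
  have split: "of_int k = of_nat (nat k) - (of_nat (nat (- k)) :: real)" for k
    by (cases "0 \<le> k") auto
  have "p x = q a c x - q (\<lambda>i. - a i) (- c) x" for x
    unfolding p q_def split[of c] split[of "a _"]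
    by (simp add: left_diff_distrib sum_subtractf)
  then show ?thesis
    using term_fun_tdiff[OF q q] by simp
qed

lemma term_fun_mcnaughton:
  assumes "n \<ge> 1" "mcnaughton (n - 1) f" "\<And>x. x \<in> cube (n - 1) \<Longrightarrow> 0 \<le> f x"
  shows "term_fun n f"
proof -
  obtain \<S> where S: "finite \<S>" "\<S> \<noteq> {}"
    "\<And>S. S \<in> \<S> \<Longrightarrow> finite S \<and> S \<noteq> {} \<and> (\<forall>p\<in>S. int_affine (n - 1) p)"
    and f: "\<And>x. x \<in> cube (n - 1) \<Longrightarrow> f x = (MAX S\<in>\<S>. MIN p\<in>S. max 0 (p x))"
    using max_min_representation[OF assms(2,3)] by blast
  have "term_fun n (\<lambda>x. MAX S\<in>\<S>. MIN p\<in>S. max 0 (p x))"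
    using S by (intro term_fun_Max term_fun_Min term_fun_int_affine assms(1)) auto
  then show ?thesis
    by (rule term_fun_cong) (simp add: f)
qed

lemma pos_cone_McN_generated:
  assumes "n \<ge> 1" "f \<in> carrier (pos_cone (McN n))"
  shows "\<exists>t\<in>hterms n. heval (pos_cone (McN n)) (McN_gen n) t = f"
proof -
  have f: "f \<in> extensional (cube (n - 1))" "mcnaughton (n - 1) f" "\<And>x. x \<in> cube (n - 1) \<Longrightarrow> 0 \<le> f x"
    using assms(2) by (auto simp: carrier_pos_cone_McN)
  obtain t where t: "t \<in> hterms n" "\<And>x. x \<in> cube (n - 1) \<Longrightarrow> geval (\<lambda>i. McN_gen n i x) t = f x"
    using term_fun_mcnaughton[OF assms(1) f(2,3)] unfolding term_fun_def by blast
  have "heval (pos_cone (McN n)) (McN_gen n) t \<in> carrier (pos_cone (McN n))"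
    using t(1) McN_gen_in_pos_cone by (intro heval_closed[OF cancellative_hoop_pos_cone_McN, where n = n]) auto
  then have "heval (pos_cone (McN n)) (McN_gen n) t = f"
    using f(1) t by (intro extensionalityI[of _ "cube (n - 1)"])
      (auto simp: heval_pos_cone_McN carrier_pos_cone_McN)
  with t(1) show ?thesis by blast
qed

theorem theorem2p1:
  fixes n :: nat
  assumes "n \<ge> 1"
  shows "(\<exists>h \<in> hoop_iso (Free_CH n) (pos_cone (McN n)).
            \<forall>i\<in>{1..n}. h (free_gen n i) = McN_gen n i) \<and>
         free_CH_on TYPE('b) (pos_cone (McN n)) {1..n} (McN_gen n)"
proof -
  interpret hoop_presentation "pos_cone (McN n)" n "McN_gen n"
    by (intro hoop_presentation.intro hoop_presentation_axioms.intro
        cancellative_hoop_pos_cone_McN)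
      (use assms McN_gen_in_pos_cone pos_cone_McN_generated pos_cone_McN_relations in auto)
  show ?thesis
    using iso_Free_CH free by blast
qed

end
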